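(* Let $N\ge2$, let $\Omega$ be a bounded domain in $\mathbb{R}^N$ with Lipschitz continuous boundary $\partial\Omega$, let $\omega\in\mathbb{S}^{N-1}$ and $\lambda\in\mathbb{R}$, and suppose that the hyperplane $\pi(\lambda,\omega)$ has non-empty intersection with $\Omega$. Assume that $\mathcal{T}_{\lambda,\omega}(\Omega^+_{\lambda,\omega})\subset\Omega$. Let $u=u(x,t)$ be the solution of $$ u_t=\Delta u \ \text{ in } \Omega\times(0,\infty),\qquad u=1\ \text{ on }\Omega\times\{0\},\qquad u=0\ \text{ on }\partial\Omega\times(0,\infty). $$ If $\Omega$ is not symmetric with respect to $\pi(\lambda,\omega)$, then $\pi(\lambda,\omega)$ does not contain any (spatial) critical point of $u$; that is, there are no $x\in\Omega\cap\pi(\lambda,\omega)$ and $t>0$ with $\nabla_x u(x,t)=0$.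
   Context: For $\omega\in\mathbb{S}^{N-1}$ (the unit sphere of $\mathbb{R}^N$) and $\lambda\in\mathbb{R}$: $\pi(\lambda,\omega)=\{x\in\mathbb{R}^N: x\cdot\omega=\lambda\}$, $\pi^+(\lambda,\omega)=\{x\in\mathbb{R}^N: x\cdot\omega>\lambda\}$, $\Omega^+_{\lambda,\omega}=\Omega\cap\pi^+(\lambda,\omega)$. $\mathcal{T}_{\lambda,\omega}(x)=x-2(x\cdot\omega)\omega+2\lambda\omega$ is the reflection of $\mathbb{R}^N$ with respect to $\pi(\lambda,\omega)$. $\Omega$ is symmetric with respect to $\pi(\lambda,\omega)$ if $\mathcal{T}_{\lambda,\omega}(\Omega)=\Omega$. *)

theory Defs
  imports "HOL-Analysis.Analysis"
begin

definition hyperplane_at :: "real \<Rightarrow> real ^ 'n \<Rightarrow> (real ^ 'n) set" where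
  "hyperplane_at \<mu> \<omega> = {x. x \<bullet> \<omega> = \<mu>}"

definition upper_halfspace :: "real \<Rightarrow> real ^ 'n \<Rightarrow> (real ^ 'n) set" where
  "upper_halfspace \<mu> \<omega> = {x. x \<bullet> \<omega> > \<mu>}"

definition refl_hyp :: "real \<Rightarrow> real ^ 'n \<Rightarrow> real ^ 'n \<Rightarrow> real ^ 'n" where
  "refl_hyp \<mu> \<omega> x = x - (2 * (x \<bullet> \<omega>)) *\<^sub>R \<omega> + (2 * \<mu>) *\<^sub>R \<omega>"

definition symmetric_wrt :: "(real ^ 'n) set \<Rightarrow> real \<Rightarrow> real ^ 'n \<Rightarrow> bool" where
  "symmetric_wrt \<Omega> \<mu> \<omega> \<longleftrightarrow> refl_hyp \<mu> \<omega> ` \<Omega> = \<Omega>"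

definition bounded_domain :: "(real ^ 'n) set \<Rightarrow> bool" where
  "bounded_domain \<Omega> \<longleftrightarrow> \<Omega> \<noteq> {} \<and> open \<Omega> \<and> connected \<Omega> \<and> bounded \<Omega>"

text \<open>
  Near every boundary point the set is the strict epigraph, in some unit direction \<open>\<nu>\<close>, of a
  Lipschitz function \<open>g\<close> on the linear hyperplane orthogonal to \<open>\<nu>\<close>. Here
  \<open>x - (x \<bullet> \<nu>) *\<^sub>R \<nu>\<close> is the orthogonal projection of \<open>x\<close> onto that hyperplane.
\<close>

definition lipschitz_boundary :: "(real ^ 'n) set \<Rightarrow> bool" where
  "lipschitz_boundary \<Omega> \<longleftrightarrow>
     (\<forall>p \<in> frontier \<Omega>. \<exists>U \<nu> (g :: real ^ 'n \<Rightarrow> real) L.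
        open U \<and> p \<in> U \<and> norm \<nu> = 1 \<and> L-lipschitz_on {y. y \<bullet> \<nu> = 0} g \<and>
        \<Omega> \<inter> U = {x \<in> U. x \<bullet> \<nu> > g (x - (x \<bullet> \<nu>) *\<^sub>R \<nu>)})"

definition partial_differentiable ::
    "'n \<Rightarrow> (real ^ 'n \<Rightarrow> real) \<Rightarrow> real ^ 'n \<Rightarrow> bool" where
  "partial_differentiable i f x \<longleftrightarrow>
     (\<lambda>s. f (x + s *\<^sub>R axis i 1)) differentiable (at 0)"

definition partial_deriv :: "'n \<Rightarrow> (real ^ 'n \<Rightarrow> real) \<Rightarrow> real ^ 'n \<Rightarrow> real" where
  "partial_deriv i f x = deriv (\<lambda>s. f (x + s *\<^sub>R axis i 1)) 0"

definition laplacian :: "(real ^ 'n \<Rightarrow> real) \<Rightarrow> real ^ 'n \<Rightarrow> real" where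
  "laplacian f x = (\<Sum>i \<in> UNIV. partial_deriv i (partial_deriv i f) x)"

text \<open>
  The class \<open>C\<^sup>2\<^sup>,\<^sup>1\<close> on \<open>\<Omega> \<times> (0,\<infinity>)\<close>, for open \<open>\<Omega>\<close>: \<open>u\<close>, its first and second spatial derivatives and
  its time derivative exist and are jointly continuous there. The existence clauses are needed
  because \<^const>\<open>deriv\<close> is total.
\<close>

definition C21 :: "(real ^ 'n) set \<Rightarrow> (real ^ 'n \<Rightarrow> real \<Rightarrow> real) \<Rightarrow> bool" where
  "C21 \<Omega> u \<longleftrightarrow>
     continuous_on (\<Omega> \<times> {0<..}) (\<lambda>(x, t). u x t) \<and>
     (\<forall>x \<in> \<Omega>. \<forall>t > 0. u x differentiable (at t)) \<and>
     continuous_on (\<Omega> \<times> {0<..}) (\<lambda>(x, t). deriv (u x) t) \<and>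
     (\<forall>i. (\<forall>x \<in> \<Omega>. \<forall>t > 0. partial_differentiable i (\<lambda>y. u y t) x) \<and>
          continuous_on (\<Omega> \<times> {0<..}) (\<lambda>(x, t). partial_deriv i (\<lambda>y. u y t) x)) \<and>
     (\<forall>i j. (\<forall>x \<in> \<Omega>. \<forall>t > 0.
               partial_differentiable j (partial_deriv i (\<lambda>y. u y t)) x) \<and>
            continuous_on (\<Omega> \<times> {0<..})
              (\<lambda>(x, t). partial_deriv j (partial_deriv i (\<lambda>y. u y t)) x))"

text \<open>
  The bounded classical solution of the heat equation with initial value 1 in \<open>\<Omega>\<close> and boundary
  value 0. The initial and boundary data are incompatible on \<open>\<partial>\<Omega> \<times> {0}\<close>, so the data are attained
  continuously everywhere except there. Boundedness is what makes the solution unique: without it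
  one may add nonzero solutions with zero data that are singular on \<open>\<partial>\<Omega> \<times> {0}\<close>.
\<close>

definition heat_solution :: "(real ^ 'n) set \<Rightarrow> (real ^ 'n \<Rightarrow> real \<Rightarrow> real) \<Rightarrow> bool" where
  "heat_solution \<Omega> u \<longleftrightarrow>
     C21 \<Omega> u \<and>
     (\<forall>x \<in> \<Omega>. \<forall>t > 0. deriv (u x) t = laplacian (\<lambda>y. u y t) x) \<and>
     (\<forall>x \<in> \<Omega>. u x 0 = 1) \<and>
     (\<forall>x \<in> frontier \<Omega>. \<forall>t > 0. u x t = 0) \<and>
     continuous_on (closure \<Omega> \<times> {0..} - frontier \<Omega> \<times> {0}) (\<lambda>(x, t). u x t) \<and>
     bounded ((\<lambda>(x, t). u x t) ` (\<Omega> \<times> {0<..}))"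

definition spatial_critical_point ::
    "(real ^ 'n \<Rightarrow> real \<Rightarrow> real) \<Rightarrow> real \<Rightarrow> real ^ 'n \<Rightarrow> bool" where
  "spatial_critical_point u t x \<longleftrightarrow> GDERIV (\<lambda>y. u y t) x :> 0"

end

theory Submission
  imports Defs
begin

text \<open>
The proof is the reflection method for the heat equation. Let \<open>T\<close> be the reflection in the hyperplane,
let the cap be the part of \<open>\<Omega>\<close> strictly above it, and put \<open>w x t = u (T x) t - u x t\<close> on the cap. This
\<open>w\<close> solves the heat equation, starts from 0, vanishes on the hyperplane, and is nonnegative on the rest
of the lateral boundary: there \<open>u x t = 0\<close>, while \<open>u (T x) t \<ge> 0\<close> because \<open>T x\<close> lies in the closure of
\<open>\<Omega>\<close>. So \<open>w \<ge> 0\<close> by the minimum principle (\<open>w_nonneg\<close>). At a point \<open>x0\<close> of \<open>\<Omega>\<close> on the hyperplane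
the derivative of \<open>w\<close> in direction \<open>\<omega>\<close> is \<open>-2\<close> times that of \<open>u\<close>, so a critical point of \<open>u\<close>
at \<open>x0\<close> would make that derivative vanish.

Consider the component \<open>C\<close> of the cap that touches \<open>x0\<close>. If \<open>w\<close> is positive somewhere in \<open>C\<close> before
the time in question, positivity spreads over \<open>C\<close> (\<open>w_spreads\<close>) and a Hopf estimate at \<open>x0\<close>
contradicts the vanishing derivative (\<open>not_critical_of_positive\<close>). Otherwise \<open>w\<close> is 0 on \<open>C\<close>, and by
continuity on its closure. At a boundary point of \<open>C\<close> above the hyperplane \<open>u\<close> is 0, so it is 0 at the
mirror image too; as \<open>u > 0\<close> inside \<open>\<Omega>\<close>, that image is not in \<open>\<Omega>\<close>. Hence \<open>C\<close>, \<open>T ` C\<close> and the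
points of \<open>\<Omega>\<close> where \<open>C\<close> touches the hyperplane together form an open and closed subset of \<open>\<Omega>\<close>,
and \<open>\<Omega>\<close> is symmetric (\<open>symmetric_of_vanishing\<close>).

Two analytic points need care. The data jump on \<open>frontier \<Omega> \<times> {0}\<close>, so the minimum principle must
ignore that set. A Lipschitz boundary is Lebesgue null, so it is covered by finitely many balls of small
total volume; a sum of heat kernels started at the centres is at least 1 near the jump and small at
positive times, and adding a multiple of it hides the jump (\<open>corner_barrier\<close>,
\<open>minimum_principle_off_corner\<close>). Secondly, one explicit subsolution on a ball that expands
in time (\<open>expanding_ball_lower_bound\<close>) gives both the spreading of positivity and the Hopf estimate,
because it is positive inside the ball and vanishes only to first order at its boundary.
\<close>

section \<open>Differentiability from continuous partial derivatives\<close>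

lemma partial_deriv_at:
  assumes "partial_differentiable i f (x + s *\<^sub>R axis i 1)"
  shows "((\<lambda>r. f (x + r *\<^sub>R axis i 1)) has_real_derivative
           partial_deriv i f (x + s *\<^sub>R axis i 1)) (at s)"
proof -
  have "((\<lambda>r. f ((x + s *\<^sub>R axis i 1) + r *\<^sub>R axis i 1)) has_real_derivative
           partial_deriv i f (x + s *\<^sub>R axis i 1)) (at 0)"
    using assms unfolding partial_differentiable_def partial_deriv_def
    by (simp add: DERIV_deriv_iff_real_differentiable)
  moreover have "(\<lambda>r. f ((x + s *\<^sub>R axis i 1) + r *\<^sub>R axis i 1)) =
      (\<lambda>r. f (x + (r + s) *\<^sub>R axis i 1))"
    by (simp add: algebra_simps)
  ultimately show ?thesis
    using DERIV_shift[of "\<lambda>r. f (x + r *\<^sub>R axis i 1)" _ 0 s] by simp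
qed

text \<open>
Moving from \<open>x\<close> to \<open>x + h\<close> one coordinate at a time, the mean value theorem controls each step. The
index set \<open>I\<close> of coordinates already moved makes this an induction.
\<close>

lemma continuous_partials_increment_bound:
  fixes f :: "real ^ 'n \<Rightarrow> real"
  assumes diff: "\<And>y i. norm (y - x) < d \<Longrightarrow> partial_differentiable i f y"
    and near: "\<And>y i. norm (y - x) < d \<Longrightarrow> \<bar>partial_deriv i f y - partial_deriv i f x\<bar> \<le> e"
    and h: "norm h < d"
  shows "\<bar>f (x + (\<chi> i. if i \<in> I then h $ i else 0)) - f x - (\<Sum>i\<in>I. h $ i * partial_deriv i f x)\<bar>
           \<le> e * (\<Sum>i\<in>I. \<bar>h $ i\<bar>)"
  using finite[of I]
proof (induction I rule: finite_induct)
  case empty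
  have "(\<chi> i. 0) = (0 :: real ^ 'n)" by (simp add: vec_eq_iff)
  then show ?case by simp
next
  case (insert k I)
  define z where "z = x + (\<chi> i. if i \<in> I then h $ i else 0)"
  define c where "c = partial_deriv k f x"
  let ?g = "\<lambda>s. f (z + s *\<^sub>R axis k 1)"
  have step: "x + (\<chi> i. if i \<in> insert k I then h $ i else 0) = z + (h $ k) *\<^sub>R axis k 1"
    using insert.hyps by (auto simp: z_def vec_eq_iff axis_def)
  have in_ball: "norm (z + s *\<^sub>R axis k 1 - x) < d" if "\<bar>s\<bar> \<le> \<bar>h $ k\<bar>" for s
  proof -
    have "norm (z + s *\<^sub>R axis k 1 - x) \<le> norm h"
      unfolding norm_vec_def
      using that insert.hyps by (intro L2_set_mono) (auto simp: z_def axis_def)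
    then show ?thesis using h by linarith
  qed
  have der: "(?g has_real_derivative partial_deriv k f (z + s *\<^sub>R axis k 1)) (at s)"
    if "\<bar>s\<bar> \<le> \<bar>h $ k\<bar>" for s
    using partial_deriv_at diff in_ball that by blast
  have "norm ((?g (h $ k) - c * (h $ k)) - (?g 0 - c * 0)) \<le> e * norm (h $ k - 0)"
  proof (rule differentiable_bound)
    show "convex {s::real. \<bar>s\<bar> \<le> \<bar>h $ k\<bar>}"
    proof -
      have "{s::real. \<bar>s\<bar> \<le> \<bar>h $ k\<bar>} = {- \<bar>h $ k\<bar> .. \<bar>h $ k\<bar>}" by auto
      then show ?thesis by simp
    qed
    show "((\<lambda>s. ?g s - c * s) has_derivative
        (\<lambda>r. (partial_deriv k f (z + s *\<^sub>R axis k 1) - c) * r))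
        (at s within {s. \<bar>s\<bar> \<le> \<bar>h $ k\<bar>})" if "s \<in> {s. \<bar>s\<bar> \<le> \<bar>h $ k\<bar>}" for s
    proof -
      have "((\<lambda>s. ?g s - c * s) has_real_derivative
          partial_deriv k f (z + s *\<^sub>R axis k 1) - c) (at s)"
        using that by (auto intro!: derivative_eq_intros der)
      then show ?thesis
        unfolding has_field_derivative_def by (rule has_derivative_at_withinI)
    qed
    show "onorm (\<lambda>r. (partial_deriv k f (z + s *\<^sub>R axis k 1) - c) * r) \<le> e"
      if "s \<in> {s. \<bar>s\<bar> \<le> \<bar>h $ k\<bar>}" for s
    proof (rule onorm_le)
      fix r
      have "\<bar>partial_deriv k f (z + s *\<^sub>R axis k 1) - c\<bar> \<le> e"
        using near in_ball that unfolding c_def by auto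
      then show "norm ((partial_deriv k f (z + s *\<^sub>R axis k 1) - c) * r) \<le> e * norm r"
        by (simp add: abs_mult mult_right_mono)
    qed
  qed auto
  then have "\<bar>f (z + (h $ k) *\<^sub>R axis k 1) - f z - h $ k * c\<bar> \<le> e * \<bar>h $ k\<bar>"
    by (simp add: algebra_simps)
  then show ?case
    using insert.IH insert.hyps unfolding step z_def[symmetric]
    by (simp add: algebra_simps c_def)
qed

lemma has_derivative_of_continuous_partials:
  fixes f :: "real ^ 'n \<Rightarrow> real"
  assumes S: "open S" "x \<in> S"
    and diff: "\<And>y i. y \<in> S \<Longrightarrow> partial_differentiable i f y"
    and cont: "\<And>i. continuous_on S (partial_deriv i f)"
  shows "(f has_derivative (\<lambda>h. \<Sum>i\<in>UNIV. h $ i * partial_deriv i f x)) (at x)"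
  unfolding has_derivative_at_alt
proof (intro conjI allI impI)
  show "bounded_linear (\<lambda>h. \<Sum>i\<in>UNIV. h $ i * partial_deriv i f x)"
    by (intro bounded_linear_sum bounded_linear_mult_left[THEN bounded_linear_compose]
        bounded_linear_vec_nth)
  fix e :: real assume "e > 0"
  define e' where "e' = e / CARD('n)"
  have "e' > 0" using \<open>e > 0\<close> by (simp add: e'_def)
  have "\<forall>\<^sub>F y in nhds x. \<forall>i. dist (partial_deriv i f y) (partial_deriv i f x) < e'"
  proof (rule eventually_all_finite)
    fix i
    have "(partial_deriv i f \<longlongrightarrow> partial_deriv i f x) (nhds x)"
      using cont[of i] S by (simp add: continuous_on_eq_continuous_at isCont_def tendsto_nhds_iff)
    then show "\<forall>\<^sub>F y in nhds x. dist (partial_deriv i f y) (partial_deriv i f x) < e'"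
      using \<open>e' > 0\<close> tendstoD by blast
  qed
  moreover have "\<forall>\<^sub>F y in nhds x. y \<in> S" using S eventually_nhds by blast
  ultimately have "\<forall>\<^sub>F y in nhds x. y \<in> S \<and>
      (\<forall>i. dist (partial_deriv i f y) (partial_deriv i f x) < e')"
    by eventually_elim auto
  then obtain d where "d > 0" and d: "\<And>y. dist y x < d \<Longrightarrow> y \<in> S \<and>
      (\<forall>i. dist (partial_deriv i f y) (partial_deriv i f x) < e')"
    unfolding eventually_nhds_metric by blast
  have "norm (f y - f x - (\<Sum>i\<in>UNIV. (y - x) $ i * partial_deriv i f x)) \<le> e * norm (y - x)"
    if y: "norm (y - x) < d" for y
  proof -
    have "\<bar>f (x + (\<chi> i. if i \<in> UNIV then (y - x) $ i else 0)) - f x -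
        (\<Sum>i\<in>UNIV. (y - x) $ i * partial_deriv i f x)\<bar> \<le> e' * (\<Sum>i\<in>UNIV. \<bar>(y - x) $ i\<bar>)"
      using y d diff by (intro continuous_partials_increment_bound[where d = d])
        (auto simp: dist_norm intro: less_imp_le)
    moreover have "x + (\<chi> i. if i \<in> UNIV then (y - x) $ i else 0) = y"
      by (simp add: vec_eq_iff)
    moreover have "e' * (\<Sum>i\<in>UNIV. \<bar>(y - x) $ i\<bar>) \<le> e' * (CARD('n) * norm (y - x))"
      using \<open>e' > 0\<close> sum_bounded_above[of UNIV "\<lambda>i. \<bar>(y - x) $ i\<bar>" "norm (y - x)"]
        component_le_norm_cart[of "y - x"]
      by (intro mult_left_mono) simp_all
    ultimately show ?thesis by (simp add: e'_def)
  qed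
  then show "\<exists>d>0. \<forall>y. norm (y - x) < d \<longrightarrow>
      norm (f y - f x - (\<Sum>i\<in>UNIV. (y - x) $ i * partial_deriv i f x)) \<le> e * norm (y - x)"
    using \<open>d > 0\<close> by blast
qed

section \<open>The heat operator at a point\<close>

text \<open>
A relation rather than a function, so that a value \<open>d\<close> of the time derivative minus the Laplacian comes
with the existence of the derivatives. Only derivatives along the coordinate lines through \<open>x\<close> enter,
which is all that a minimum controls; this makes sums and multiples immediate.
\<close>

definition has_heat_defect :: "(real ^ 'n \<Rightarrow> real \<Rightarrow> real) \<Rightarrow> real ^ 'n \<Rightarrow> real \<Rightarrow> real \<Rightarrow> bool" where
  "has_heat_defect v x t d \<longleftrightarrow>
     (\<exists>a (p :: 'n \<Rightarrow> real \<Rightarrow> real) q.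
        (v x has_real_derivative a) (at t) \<and>
        (\<forall>i. (\<forall>\<^sub>F s in nhds 0. ((\<lambda>s. v (x + s *\<^sub>R axis i 1) t) has_real_derivative p i s) (at s)) \<and>
             (p i has_real_derivative q i) (at 0)) \<and>
        d = a - (\<Sum>i\<in>UNIV. q i))"

lemma has_heat_defect_add:
  assumes "has_heat_defect v x t d" "has_heat_defect w x t e"
  shows "has_heat_defect (\<lambda>x t. v x t + w x t) x t (d + e)"
proof -
  obtain a p q where 1: "(v x has_real_derivative a) (at t)"
    "\<And>i. \<forall>\<^sub>F s in nhds 0. ((\<lambda>s. v (x + s *\<^sub>R axis i 1) t) has_real_derivative p i s) (at s)"
    "\<And>i. (p i has_real_derivative q i) (at 0)" "d = a - (\<Sum>i\<in>UNIV. q i)"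
    using assms(1) unfolding has_heat_defect_def by blast
  obtain a' p' q' where 2: "(w x has_real_derivative a') (at t)"
    "\<And>i. \<forall>\<^sub>F s in nhds 0. ((\<lambda>s. w (x + s *\<^sub>R axis i 1) t) has_real_derivative p' i s) (at s)"
    "\<And>i. (p' i has_real_derivative q' i) (at 0)" "e = a' - (\<Sum>i\<in>UNIV. q' i)"
    using assms(2) unfolding has_heat_defect_def by blast
  show ?thesis unfolding has_heat_defect_def
  proof (intro exI conjI allI)
    show "((\<lambda>t. v x t + w x t) has_real_derivative a + a') (at t)" by (intro DERIV_add 1 2)
    show "\<forall>\<^sub>F s in nhds 0. ((\<lambda>s. v (x + s *\<^sub>R axis i 1) t + w (x + s *\<^sub>R axis i 1) t)
        has_real_derivative p i s + p' i s) (at s)" for i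
      using 1(2)[of i] 2(2)[of i] by eventually_elim (rule DERIV_add)
    show "((\<lambda>s. p i s + p' i s) has_real_derivative q i + q' i) (at 0)" for i
      by (intro DERIV_add 1 2)
    show "d + e = a + a' - (\<Sum>i\<in>UNIV. q i + q' i)" using 1 2 by (simp add: sum.distrib)
  qed
qed

lemma has_heat_defect_cmult:
  assumes "has_heat_defect v x t d"
  shows "has_heat_defect (\<lambda>x t. c * v x t) x t (c * d)"
proof -
  obtain a p q where 1: "(v x has_real_derivative a) (at t)"
    "\<And>i. \<forall>\<^sub>F s in nhds 0. ((\<lambda>s. v (x + s *\<^sub>R axis i 1) t) has_real_derivative p i s) (at s)"
    "\<And>i. (p i has_real_derivative q i) (at 0)" "d = a - (\<Sum>i\<in>UNIV. q i)"
    using assms(1) unfolding has_heat_defect_def by blast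
  show ?thesis unfolding has_heat_defect_def
  proof (intro exI conjI allI)
    show "((\<lambda>t. c * v x t) has_real_derivative c * a) (at t)" by (intro DERIV_cmult 1)
    show "\<forall>\<^sub>F s in nhds 0. ((\<lambda>s. c * v (x + s *\<^sub>R axis i 1) t)
        has_real_derivative c * p i s) (at s)" for i
      using 1(2)[of i] by eventually_elim (rule DERIV_cmult)
    show "((\<lambda>s. c * p i s) has_real_derivative c * q i) (at 0)" for i
      by (intro DERIV_cmult 1)
    show "c * d = c * a - (\<Sum>i\<in>UNIV. c * q i)"
      using 1 by (simp add: sum_distrib_left right_diff_distrib)
  qed
qed

lemma has_heat_defect_sum:
  assumes "finite Y" "\<And>y. y \<in> Y \<Longrightarrow> has_heat_defect (v y) x t (d y)"
  shows "has_heat_defect (\<lambda>x t. \<Sum>y\<in>Y. v y x t) x t (\<Sum>y\<in>Y. d y)"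
  using assms
proof (induction Y rule: finite_induct)
  case empty
  show ?case unfolding has_heat_defect_def
    by (rule exI[of _ 0], rule exI[of _ "\<lambda>_ _. 0"], rule exI[of _ "\<lambda>_. 0"]) auto
next
  case (insert y Y)
  then show ?case using has_heat_defect_add[of "v y" x t "d y"] by simp
qed

lemma second_derivative_nonneg_at_min:
  fixes f :: "real \<Rightarrow> real"
  assumes f: "\<forall>\<^sub>F s in nhds 0. (f has_real_derivative p s) (at s)"
    and p: "(p has_real_derivative q) (at 0)"
    and min: "\<forall>\<^sub>F s in nhds 0. f 0 \<le> f s"
  shows "0 \<le> q"
proof (rule ccontr)
  assume "\<not> 0 \<le> q"
  then have "q < 0" by simp
  obtain d where d: "d > 0" "\<And>s. \<bar>s\<bar> < d \<Longrightarrow> (f has_real_derivative p s) (at s)"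
      "\<And>s. \<bar>s\<bar> < d \<Longrightarrow> f 0 \<le> f s"
    using eventually_conj[OF f min] unfolding eventually_nhds_metric by (auto simp: dist_norm)
  have "p 0 = 0"
    using DERIV_local_min[of f "p 0" 0 d] d by auto
  obtain e where e: "e > 0" "\<And>h. 0 < h \<Longrightarrow> h < e \<Longrightarrow> p h < 0"
    using DERIV_neg_dec_right[OF p \<open>q < 0\<close>] \<open>p 0 = 0\<close> by auto
  define h where "h = min d e / 2"
  have h: "0 < h" "h < d" "h < e" using d e by (auto simp: h_def)
  have "f h < f 0"
  proof (rule DERIV_neg_imp_decreasing_open[OF h(1)])
    show "\<And>s. 0 < s \<Longrightarrow> s < h \<Longrightarrow> \<exists>y. (f has_real_derivative y) (at s) \<and> y < 0"
      using d(2) e(2) h by (metis abs_of_pos less_trans)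
    show "continuous_on {0..h} f"
    proof (intro continuous_at_imp_continuous_on ballI)
      fix s assume "s \<in> {0..h}"
      then show "isCont f s" using h by (intro DERIV_isCont[OF d(2)]) auto
    qed
  qed
  with d(3)[of h] h show False by simp
qed

text \<open>
Only times up to \<open>t\<close> are compared, so at the minimum the time derivative is at most 0 rather than equal
to 0; the second derivatives are nonnegative.
\<close>

lemma heat_defect_nonpos_at_min:
  fixes v :: "real ^ 'n \<Rightarrow> real \<Rightarrow> real"
  assumes dfct: "has_heat_defect v x t d" and "e > 0"
    and min: "\<And>x' t'. dist x' x < e \<Longrightarrow> t - e < t' \<Longrightarrow> t' \<le> t \<Longrightarrow> v x t \<le> v x' t'"
  shows "d \<le> 0"
proof -
  obtain a p q where 1: "(v x has_real_derivative a) (at t)"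
    "\<And>i. \<forall>\<^sub>F s in nhds 0. ((\<lambda>s. v (x + s *\<^sub>R axis i 1) t) has_real_derivative p i s) (at s)"
    "\<And>i. (p i has_real_derivative q i) (at 0)" "d = a - (\<Sum>i\<in>UNIV. q i)"
    using dfct unfolding has_heat_defect_def by blast
  have "0 \<le> q i" for i
  proof (rule second_derivative_nonneg_at_min[OF 1(2)[of i] 1(3)[of i]])
    show "\<forall>\<^sub>F s in nhds 0. v (x + 0 *\<^sub>R axis i 1) t \<le> v (x + s *\<^sub>R axis i 1) t"
      unfolding eventually_nhds_metric using \<open>e > 0\<close> min
      by (intro exI[of _ e]) (auto simp: dist_norm)
  qed
  then have "0 \<le> (\<Sum>i\<in>UNIV. q i)" by (simp add: sum_nonneg)
  moreover have "a \<le> 0"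
  proof (rule ccontr)
    assume "\<not> a \<le> 0"
    then obtain c where c: "c > 0" "\<And>h. 0 < h \<Longrightarrow> h < c \<Longrightarrow> v x (t - h) < v x t"
      using DERIV_pos_inc_left[OF 1(1)] by auto
    define h where "h = min c e / 2"
    have "0 < h" "h < c" "h < e" using c \<open>e > 0\<close> by (auto simp: h_def)
    then show False using c(2)[of h] min[of x "t - h"] \<open>e > 0\<close> by simp
  qed
  ultimately show ?thesis using 1 by linarith
qed

section \<open>Minimum principle with an exceptional null set at the initial time\<close>

text \<open>
Adding \<open>\<delta> * t\<close> makes the defect strictly positive, so a negative minimum cannot lie in the parabolic
interior \<open>I\<close>. Compactness is asked only of the part \<open>P\<close> of the region \<open>S\<close>: outside \<open>P\<close> the sign is
known in advance, which is how a neighbourhood of the discontinuous corner is cut away.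
\<close>

lemma weak_minimum_principle:
  fixes v :: "real ^ 'n \<Rightarrow> real \<Rightarrow> real"
  assumes PS: "P \<subseteq> S" "compact P"
    and cont: "continuous_on P (\<lambda>(x, t). v x t)"
    and time: "\<And>x t. (x, t) \<in> S \<Longrightarrow> 0 \<le> t"
    and outside: "\<And>x t. (x, t) \<in> S \<Longrightarrow> (x, t) \<notin> P \<Longrightarrow> 0 \<le> v x t"
    and boundary: "\<And>x t. (x, t) \<in> S \<Longrightarrow> (x, t) \<notin> I \<Longrightarrow> 0 \<le> v x t"
    and past: "\<And>x t. (x, t) \<in> I \<Longrightarrow> \<exists>e>0. \<forall>x' t'. dist x' x < e \<longrightarrow> t - e < t' \<longrightarrow> t' \<le> t \<longrightarrow> (x', t') \<in> S"
    and super: "\<And>x t. (x, t) \<in> I \<Longrightarrow> \<exists>d\<ge>0. has_heat_defect v x t d"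
    and xt: "(x, t) \<in> S"
  shows "0 \<le> v x t"
proof (rule field_le_epsilon)
  fix \<epsilon> :: real assume "\<epsilon> > 0"
  define \<delta> where "\<delta> = \<epsilon> / (t + 1)"
  have "0 \<le> t" using time xt by blast
  then have \<delta>: "\<delta> > 0" "\<delta> * t \<le> \<epsilon>" using \<open>\<epsilon> > 0\<close> by (auto simp: \<delta>_def field_simps)
  define V where "V x t = v x t + \<delta> * t" for x t
  have V: "v x t \<le> V x t" if "(x, t) \<in> S" for x t
    using time[OF that] \<delta> by (simp add: V_def)
  have "0 \<le> V x t"
  proof (rule ccontr)
    assume neg: "\<not> 0 \<le> V x t"
    then have xP: "(x, t) \<in> P" using outside V xt by fastforce
    have "continuous_on P (\<lambda>p. (\<lambda>(x, t). v x t) p + \<delta> * snd p)"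
      by (intro continuous_intros cont)
    then have "continuous_on P (\<lambda>(x, t). V x t)"
      by (simp add: V_def case_prod_beta)
    then obtain z s where zs: "(z, s) \<in> P" and min: "\<And>y r. (y, r) \<in> P \<Longrightarrow> V z s \<le> V y r"
      using continuous_attains_inf[OF \<open>compact P\<close>] xP by fastforce
    have "V z s < 0" using min[OF xP] neg by simp
    have zS: "(z, s) \<in> S" using zs PS by blast
    then have zI: "(z, s) \<in> I" using boundary V \<open>V z s < 0\<close> by fastforce
    have min_S: "V z s \<le> V y r" if "(y, r) \<in> S" for y r
      using min outside[OF that] V[OF that] \<open>V z s < 0\<close> by fastforce
    obtain e where e: "e > 0"
        "\<And>x' t'. dist x' z < e \<Longrightarrow> s - e < t' \<Longrightarrow> t' \<le> s \<Longrightarrow> (x', t') \<in> S"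
      using past[OF zI] by blast
    obtain d where d: "d \<ge> 0" "has_heat_defect v z s d" using super[OF zI] by blast
    have "has_heat_defect (\<lambda>x t. \<delta> * t) z s \<delta>"
      unfolding has_heat_defect_def
      by (rule exI[of _ \<delta>], rule exI[of _ "\<lambda>_ _. 0"], rule exI[of _ "\<lambda>_. 0"])
        (auto intro!: derivative_eq_intros)
    from has_heat_defect_add[OF d(2) this]
    have "has_heat_defect V z s (d + \<delta>)" by (simp add: V_def[abs_def])
    then have "d + \<delta> \<le> 0"
      using heat_defect_nonpos_at_min[OF _ e(1)] e(2) min_S by blast
    then show False using d \<delta> by linarith
  qed
  then show "0 \<le> v x t + \<epsilon>" using \<delta> by (simp add: V_def)
qed

text \<open>
The balls of radius \<open>r / 2\<close> around \<open>r\<close>-separated points are disjoint, so their volumes add up.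
\<close>

lemma separated_subset_card_bound:
  fixes Y :: "'a::euclidean_space set" and r :: real
  assumes "finite Y" "0 < r" and sep: "pairwise (\<lambda>x y. r \<le> dist x y) Y"
    and U: "U \<in> lmeasurable" "\<And>y. y \<in> Y \<Longrightarrow> ball y (r / 2) \<subseteq> U"
  shows "card Y * r ^ DIM('a) \<le> (2 ^ DIM('a) / unit_ball_vol (DIM('a))) * measure lebesgue U"
proof -
  let ?b = "unit_ball_vol (DIM('a)) * (r / 2) ^ DIM('a)"
  have m: "measure lebesgue (ball y (r / 2)) = ?b" for y :: 'a
    using content_ball[of "r/2" y] \<open>0 < r\<close> by simp
  have disj: "disjoint_family_on (\<lambda>y. ball y (r / 2)) Y"
    unfolding disjoint_family_on_def
  proof (intro ballI impI)
    fix x y assume "x \<in> Y" "y \<in> Y" "x \<noteq> y"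
    then have "r / 2 + r / 2 \<le> dist x y" using sep by (simp add: pairwise_def)
    then show "ball x (r / 2) \<inter> ball y (r / 2) = {}" by (rule disjoint_ballI)
  qed
  have "card Y * ?b = measure lebesgue (\<Union>y\<in>Y. ball y (r / 2))"
    by (subst measure_finite_Union[OF \<open>finite Y\<close> _ disj])
      (auto simp: m fmeasurableD2[OF lmeasurable_ball] simp del: emeasure_completion)
  also have "\<dots> \<le> measure lebesgue U"
    using U \<open>finite Y\<close> by (intro measure_mono_fmeasurable) auto
  finally show ?thesis
    using unit_ball_vol_pos[of "DIM('a)"] by (simp add: field_simps power_divide)
qed

text \<open>
An \<open>r\<close>-separated subset of \<open>K\<close> of largest size covers \<open>K\<close> by balls of radius \<open>r\<close>; for small \<open>r\<close> its
half-size balls fit in an open set of small measure around \<open>K\<close>. Equal radii keep the barrier built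
from this cover a plain sum of translates.
\<close>

lemma negligible_compact_ball_cover:
  fixes K :: "'a::euclidean_space set" and \<epsilon> :: real
  assumes K: "compact K" "negligible K" and "\<epsilon> > 0"
  obtains Y and r :: real where "finite Y" "0 < r" "K \<subseteq> (\<Union>y\<in>Y. ball y r)" "card Y * r ^ DIM('a) \<le> \<epsilon>"
proof -
  define c where "c = 2 ^ DIM('a) / unit_ball_vol (DIM('a))"
  have "c > 0" using unit_ball_vol_pos[of "DIM('a)"] by (simp add: c_def)
  have "K \<in> sets lebesgue" using K by (simp add: negligible_imp_sets)
  then obtain U where U: "open U" "K \<subseteq> U" "U - K \<in> lmeasurable"
      "emeasure lebesgue (U - K) < ennreal (\<epsilon> / c)"
    using sets_lebesgue_outer_open[of K "\<epsilon> / c"] \<open>\<epsilon> > 0\<close> \<open>c > 0\<close> by auto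
  have "U = (U - K) \<union> K" using U by blast
  then have Um: "U \<in> lmeasurable"
    using fmeasurable.Un[OF U(3) negligible_imp_measurable[OF K(2)]] by simp
  have "measure lebesgue U = measure lebesgue (U - K)"
    using measure_Diff_null_set[of U lebesgue K] K Um
    by (simp add: negligible_iff_null_sets fmeasurableD)
  also have "\<dots> < \<epsilon> / c"
    using U(3,4) \<open>\<epsilon> > 0\<close> \<open>c > 0\<close>
    by (metis (no_types, lifting) emeasure_eq_measure2 ennreal_less_iff measure_nonneg)
  finally have mU: "c * measure lebesgue U < \<epsilon>" using \<open>c > 0\<close> by (simp add: field_simps)
  obtain r where "r > 0" and r: "(\<Union>y\<in>K. ball y r) \<subseteq> U"
    using compact_subset_open_imp_ball_epsilon_subset[OF K(1) U(1,2)] by metis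
  define Q where "Q Y \<longleftrightarrow> finite Y \<and> Y \<subseteq> K \<and> pairwise (\<lambda>x y. r \<le> dist x y) Y" for Y
  have bound: "card Y * r ^ DIM('a) \<le> c * measure lebesgue U" if "Q Y" for Y
  proof -
    have "ball y (r / 2) \<subseteq> U" if "y \<in> Y" for y
    proof -
      have "ball y (r / 2) \<subseteq> ball y r" using \<open>r > 0\<close> by (intro subset_ball) simp
      then show ?thesis using r that \<open>Q Y\<close> unfolding Q_def by blast
    qed
    then show ?thesis
      using that \<open>r > 0\<close> Um unfolding c_def Q_def by (intro separated_subset_card_bound) auto
  qed
  have "Q {}" by (simp add: Q_def)
  moreover have "\<forall>Y. Q Y \<longrightarrow> card Y < Suc (nat \<lfloor>c * measure lebesgue U / r ^ DIM('a)\<rfloor>)"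
  proof (intro allI impI)
    fix Y assume "Q Y"
    then have "real (card Y) \<le> c * measure lebesgue U / r ^ DIM('a)"
      using bound \<open>r > 0\<close> by (simp add: field_simps)
    then show "card Y < Suc (nat \<lfloor>c * measure lebesgue U / r ^ DIM('a)\<rfloor>)" by linarith
  qed
  ultimately have "\<exists>Y. Q Y \<and> (\<forall>Z. Q Z \<longrightarrow> card Z \<le> card Y)"
    by (rule Lattices_Big.ex_has_greatest_nat)
  then obtain Y where Y: "Q Y" "\<And>Z. Q Z \<Longrightarrow> card Z \<le> card Y" by blast
  have "K \<subseteq> (\<Union>y\<in>Y. ball y r)"
  proof
    fix x assume "x \<in> K"
    show "x \<in> (\<Union>y\<in>Y. ball y r)"
    proof (rule ccontr)
      assume "x \<notin> (\<Union>y\<in>Y. ball y r)"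
      then have far: "\<And>y. y \<in> Y \<Longrightarrow> r \<le> dist y x" by (auto simp: not_less)
      then have "x \<notin> Y" using \<open>r > 0\<close> by fastforce
      have "Q (insert x Y)"
        using Y(1) far \<open>x \<in> K\<close> by (auto simp: Q_def pairwise_insert dist_commute)
      from Y(2)[OF this] show False using \<open>x \<notin> Y\<close> Y(1) by (simp add: Q_def)
    qed
  qed
  moreover have "card Y * r ^ DIM('a) \<le> \<epsilon>" using bound[OF Y(1)] mU by simp
  ultimately show thesis using that Y(1) \<open>r > 0\<close> by (auto simp: Q_def)
qed

text \<open>
The heat kernel at time \<open>\<tau>\<close>, up to the factor \<open>(4 * pi) powr (- N / 2)\<close>.
\<close>

definition gauss :: "real ^ 'n \<Rightarrow> real ^ 'n \<Rightarrow> real \<Rightarrow> real" where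
  "gauss y x \<tau> = \<tau> powr (- real CARD('n) / 2) * exp (- (norm (x - y))\<^sup>2 / (4 * \<tau>))"

lemma norm_line_derivative:
  fixes x y :: "real ^ 'n"
  shows "((\<lambda>s. (norm (x + s *\<^sub>R axis i 1 - y))\<^sup>2) has_real_derivative 2 * (x $ i + s - y $ i)) (at s)"
proof -
  have "(norm (x + s *\<^sub>R axis i 1 - y))\<^sup>2 = (norm (x - y))\<^sup>2 + 2 * s * (x $ i - y $ i) + s\<^sup>2" for s
  proof -
    have "x + s *\<^sub>R axis i 1 - y = (x - y) + s *\<^sub>R axis i 1" by simp
    moreover have "(x - y) \<bullet> (s *\<^sub>R axis i 1) = s * (x $ i - y $ i)" by (simp add: inner_axis)
    ultimately show ?thesis
      using dot_norm[of "x - y" "s *\<^sub>R axis i 1"] by (simp add: field_simps norm_axis_1)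
  qed
  then have "(\<lambda>s. (norm (x + s *\<^sub>R axis i 1 - y))\<^sup>2) =
      (\<lambda>s. (norm (x - y))\<^sup>2 + 2 * s * (x $ i - y $ i) + s\<^sup>2)" by blast
  then show ?thesis by (auto intro!: derivative_eq_intros)
qed

lemma gauss_heat_defect:
  fixes x y :: "real ^ 'n"
  assumes "0 < t + b"
  shows "has_heat_defect (\<lambda>x t. gauss y x (t + b)) x t 0"
proof -
  define \<tau> where "\<tau> = t + b"
  have "\<tau> > 0" using assms by (simp add: \<tau>_def)
  let ?N = "real CARD('n)"
  let ?G = "gauss y x \<tau>"
  let ?G' = "\<lambda>i s. gauss y (x + s *\<^sub>R axis i 1) \<tau>"
  let ?p = "\<lambda>i s. - ((x $ i + s - y $ i) / (2 * \<tau>)) * ?G' i s"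
  let ?q = "\<lambda>i. ((x $ i - y $ i)\<^sup>2 / (4 * \<tau>\<^sup>2) - 1 / (2 * \<tau>)) * ?G"
  have G': "(?G' i has_real_derivative ?p i s) (at s)" for i s
  proof -
    define z where "z s = (norm (x + s *\<^sub>R axis i 1 - y))\<^sup>2" for s
    have z: "(z has_real_derivative 2 * (x $ i + s - y $ i)) (at s)"
      unfolding z_def[abs_def] by (rule norm_line_derivative)
    show ?thesis
      unfolding gauss_def z_def[symmetric]
      using \<open>\<tau> > 0\<close> by (auto intro!: derivative_eq_intros z simp: field_simps)
  qed
  have p: "(?p i has_real_derivative ?q i) (at 0)" for i
    using \<open>\<tau> > 0\<close> by (auto intro!: derivative_eq_intros G' simp: field_simps power2_eq_square)
  have "((\<lambda>\<tau>. gauss y x \<tau>) has_real_derivative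
      ((norm (x - y))\<^sup>2 / (4 * \<tau>\<^sup>2) - ?N / (2 * \<tau>)) * ?G) (at \<tau>)"
  proof -
    define e where "e = - ?N / 2"
    have "((\<lambda>\<tau>. \<tau> powr e) has_real_derivative e * (\<tau> powr e / \<tau>)) (at \<tau>)"
      using has_real_derivative_powr[OF \<open>\<tau> > 0\<close>, of e] \<open>\<tau> > 0\<close> by (simp add: powr_diff)
    moreover have "?N = - 2 * e" by (simp add: e_def)
    ultimately show ?thesis
      unfolding gauss_def e_def[symmetric] using \<open>\<tau> > 0\<close>
      by (auto intro!: derivative_eq_intros simp: field_simps power2_eq_square powr_diff)
  qed
  then have t: "((\<lambda>t. gauss y x (t + b)) has_real_derivative
      ((norm (x - y))\<^sup>2 / (4 * \<tau>\<^sup>2) - ?N / (2 * \<tau>)) * ?G) (at t)"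
    using DERIV_shift[of "\<lambda>\<tau>. gauss y x \<tau>" _ t b] by (simp add: \<tau>_def)
  have "(norm (x - y))\<^sup>2 = (\<Sum>i\<in>UNIV. (x $ i - y $ i)\<^sup>2)"
    by (simp add: norm_vec_def L2_set_def sum_nonneg)
  then have "0 = ((norm (x - y))\<^sup>2 / (4 * \<tau>\<^sup>2) - ?N / (2 * \<tau>)) * ?G - (\<Sum>i\<in>UNIV. ?q i)"
    by (simp add: sum_distrib_right[symmetric] sum_subtractf sum_divide_distrib[symmetric])
  then show ?thesis
    unfolding has_heat_defect_def \<tau>_def[symmetric] using t p G'
    by (intro exI[of _ "((norm (x - y))\<^sup>2 / (4 * \<tau>\<^sup>2) - ?N / (2 * \<tau>)) * ?G"]
        exI[of _ ?p] exI[of _ ?q]) auto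
qed

text \<open>
Each ball of the cover contributes the heat kernel started at time \<open>- r\<^sup>2\<close> at its centre and scaled by
\<open>r ^ N\<close>. At time 0 this is bounded below on the ball by a constant independent of \<open>r\<close>, while at
time \<open>t > 0\<close> it is at most a constant times \<open>r ^ N * t powr (- N / 2)\<close>.
\<close>

lemma corner_barrier:
  fixes K :: "(real ^ 'n) set"
  assumes K: "compact K" "negligible K" and "\<epsilon> > 0"
  obtains \<psi> :: "real ^ 'n \<Rightarrow> real \<Rightarrow> real"
  where "\<And>x t. 0 \<le> t \<Longrightarrow> has_heat_defect \<psi> x t 0"
    and "continuous_on (UNIV \<times> {0..}) (\<lambda>(x, t). \<psi> x t)"
    and "\<And>x t. 0 \<le> t \<Longrightarrow> 0 \<le> \<psi> x t"
    and "\<And>x. x \<in> K \<Longrightarrow> 1 < \<psi> x 0"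
    and "\<And>x t. 0 < t \<Longrightarrow> \<psi> x t \<le> \<epsilon> * t powr (- real CARD('n) / 2)"
proof -
  let ?N = "CARD('n)"
  \<comment> \<open>On a ball of radius \<open>r\<close> the exponential factor at time 0 is at least \<open>exp (- 1 / 4)\<close>;
    the factor 2 makes the lower bound strict.\<close>
  define c :: real where "c = 2 * exp (1 / 4)"
  have "c > 0" by (simp add: c_def)
  obtain Y and r :: real where Y: "finite Y" "0 < r" "K \<subseteq> (\<Union>y\<in>Y. ball y r)" "card Y * r ^ ?N \<le> \<epsilon> / c"
    using negligible_compact_ball_cover[OF K, of "\<epsilon> / c"] \<open>\<epsilon> > 0\<close> \<open>c > 0\<close> by auto
  define g where "g y x t = c * r ^ ?N * gauss y x (t + r\<^sup>2)" for y x :: "real ^ 'n" and t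
  define \<psi> where "\<psi> x t = (\<Sum>y\<in>Y. g y x t)" for x t
  have pos: "0 < t + r\<^sup>2" if "0 \<le> t" for t using that Y(2) by (simp add: add_nonneg_pos)
  have g_nonneg: "0 \<le> g y x t" for y x t
    using Y(2) \<open>c > 0\<close> by (simp add: g_def gauss_def)
  have r_powr: "(r\<^sup>2) powr (- real ?N / 2) = inverse (r ^ ?N)"
  proof -
    have "r\<^sup>2 = r powr 2" using Y(2) by (simp add: powr_numeral)
    moreover have "(r powr 2) powr (- real ?N / 2) = r powr (2 * (- real ?N / 2))"
      by (rule powr_powr)
    moreover have "2 * (- real ?N / 2) = - real ?N" by simp
    ultimately have "(r\<^sup>2) powr (- real ?N / 2) = r powr (- real ?N)" by metis
    then show ?thesis using Y(2) by (simp only: powr_minus powr_realpow)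
  qed
  show thesis
  proof
    show "has_heat_defect \<psi> x t 0" if "0 \<le> t" for x t
    proof -
      have "has_heat_defect (g y) x t 0" for y
        using has_heat_defect_cmult[OF gauss_heat_defect[OF pos[OF that]], of "c * r ^ ?N"]
        by (simp add: g_def[abs_def])
      then show ?thesis
        using has_heat_defect_sum[OF Y(1), of g x t "\<lambda>_. 0"] by (simp add: \<psi>_def[abs_def])
    qed
    show "continuous_on (UNIV \<times> {0..}) (\<lambda>(x, t). \<psi> x t)"
    proof -
      have "4 * (snd p + r\<^sup>2) \<noteq> 0" "snd p + r\<^sup>2 \<noteq> 0" if "p \<in> UNIV \<times> {0..}" for p :: "(real ^ 'n) \<times> real"
        using pos[of "snd p"] that by (force, force)
      then show ?thesis
        unfolding \<psi>_def g_def gauss_def case_prod_beta by (intro continuous_intros) blast+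
    qed
    show "0 \<le> \<psi> x t" if "0 \<le> t" for x t
      unfolding \<psi>_def using g_nonneg by (intro sum_nonneg)
    show "1 < \<psi> x 0" if x: "x \<in> K" for x
    proof -
      obtain y where y: "y \<in> Y" "dist y x < r"
        using Y(3) x by auto
      have "(norm (x - y))\<^sup>2 \<le> r\<^sup>2"
        using y(2) by (intro power_mono) (auto simp: dist_norm norm_minus_commute)
      then have "- (1 / 4) \<le> - (norm (x - y))\<^sup>2 / (4 * r\<^sup>2)" using Y(2) by (simp add: field_simps)
      then have "exp (- (1 / 4)) \<le> exp (- (norm (x - y))\<^sup>2 / (4 * r\<^sup>2))" by (simp only: exp_le_cancel_iff)
      moreover have "g y x 0 = c * exp (- (norm (x - y))\<^sup>2 / (4 * r\<^sup>2))"
        unfolding g_def gauss_def add_0 r_powr using Y(2) by simp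
      ultimately have "c * exp (- (1 / 4)) \<le> g y x 0"
        using \<open>c > 0\<close> by simp
      then have "1 < g y x 0" by (simp add: c_def mult.assoc flip: exp_add)
      also have "\<dots> \<le> \<psi> x 0"
        unfolding \<psi>_def using Y(1) y(1) g_nonneg by (intro member_le_sum) auto
      finally show ?thesis .
    qed
    show "\<psi> x t \<le> \<epsilon> * t powr (- real ?N / 2)" if "0 < t" for x t
    proof -
      have "gauss y x (t + r\<^sup>2) \<le> t powr (- real ?N / 2) * 1" for y :: "real ^ 'n"
        unfolding gauss_def using that
        by (intro mult_mono powr_mono2') (auto simp: field_simps)
      then have "g y x t \<le> c * r ^ ?N * t powr (- real ?N / 2)" for y
        unfolding g_def using \<open>c > 0\<close> Y(2) by (intro mult_left_mono) auto
      then have "\<psi> x t \<le> card Y * (c * r ^ ?N * t powr (- real ?N / 2))"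
        unfolding \<psi>_def by (intro sum_bounded_above) auto
      also have "\<dots> = (card Y * r ^ ?N) * (c * t powr (- real ?N / 2))" by simp
      also have "\<dots> \<le> (\<epsilon> / c) * (c * t powr (- real ?N / 2))"
        using Y(4) \<open>c > 0\<close> by (intro mult_right_mono) auto
      finally show ?thesis using \<open>c > 0\<close> by simp
    qed
  qed
qed

text \<open>
The data may jump at \<open>frontier D \<times> {0}\<close>, where a lower bound for \<open>w\<close> takes the place of
continuity. Where the barrier exceeds 1 that bound is compensated, and the remaining closed region avoids the corner. Letting the
barrier tend to 0 at the fixed point removes it again.
\<close>

lemma minimum_principle_off_corner:
  fixes D :: "(real ^ 'n) set" and w :: "real ^ 'n \<Rightarrow> real \<Rightarrow> real"
  assumes D: "open D" "bounded D" "negligible (frontier D)"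
    and cont: "continuous_on (closure D \<times> {0..} - frontier D \<times> {0}) (\<lambda>(x, t). w x t)"
    and lower: "\<And>x t. x \<in> D \<Longrightarrow> 0 < t \<Longrightarrow> - M \<le> w x t"
    and initial: "\<And>x. x \<in> D \<Longrightarrow> 0 \<le> w x 0"
    and lateral: "\<And>x t. x \<in> frontier D \<Longrightarrow> 0 < t \<Longrightarrow> 0 \<le> w x t"
    and super: "\<And>x t. x \<in> D \<Longrightarrow> 0 < t \<Longrightarrow> has_heat_defect w x t 0"
    and x: "x \<in> D" and t: "0 < t"
  shows "0 \<le> w x t"
proof (rule field_le_epsilon)
  fix \<eta> :: real assume "\<eta> > 0"
  define m where "m = max M 1"
  define \<epsilon> where "\<epsilon> = \<eta> / (m * t powr (- real CARD('n) / 2))"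
  have "m > 0" by (simp add: m_def)
  have "\<epsilon> > 0" using \<open>\<eta> > 0\<close> \<open>m > 0\<close> t by (simp add: \<epsilon>_def)
  have "compact (frontier D)" using D(2) compact_frontier_bounded by blast
  from corner_barrier[OF this D(3) \<open>\<epsilon> > 0\<close>]
  obtain \<psi> :: "real ^ 'n \<Rightarrow> real \<Rightarrow> real" where \<psi>:
      "\<And>x t. 0 \<le> t \<Longrightarrow> has_heat_defect \<psi> x t 0"
      "continuous_on (UNIV \<times> {0..}) (\<lambda>(x, t). \<psi> x t)"
      "\<And>x t. 0 \<le> t \<Longrightarrow> 0 \<le> \<psi> x t"
      "\<And>x. x \<in> frontier D \<Longrightarrow> 1 < \<psi> x 0"
      "\<And>x t. 0 < t \<Longrightarrow> \<psi> x t \<le> \<epsilon> * t powr (- real CARD('n) / 2)"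
    by blast
  let ?T = "closure D \<times> {0..t}"
  define S where "S = ?T - frontier D \<times> {0}"
  \<comment> \<open>The closed part where the barrier is at most 1; it misses \<open>frontier D \<times> {0}\<close>.\<close>
  define P where "P = {p \<in> ?T. (\<lambda>(x, t). \<psi> x t) p \<le> 1}"
  define v where "v x t = w x t + m * \<psi> x t" for x t
  have cont_\<psi>: "continuous_on A (\<lambda>(x, t). \<psi> x t)" if "A \<subseteq> UNIV \<times> {0..}" for A
    using \<psi>(2) that continuous_on_subset by blast
  have frontier_D: "closure D = D \<union> frontier D" using closure_Un_frontier by blast
  have "0 \<le> v x t"
  proof (rule weak_minimum_principle[where v = v and x = x and t = t and P = P and S = S and I = "D \<times> {0<..t}"])
    show "P \<subseteq> S" using \<psi>(4) by (force simp: P_def S_def)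
    have "closed P"
      unfolding P_def
      by (intro continuous_on_closed_Collect_le cont_\<psi> continuous_intros closed_Times) auto
    moreover have "bounded P"
      using D(2) by (intro bounded_subset[OF bounded_Times[of "closure D" "{0..t}"]])
        (auto simp: P_def)
    ultimately show "compact P" using compact_eq_bounded_closed by blast
    have "P \<subseteq> closure D \<times> {0..} - frontier D \<times> {0}"
      using \<open>P \<subseteq> S\<close> by (auto simp: S_def)
    then have "continuous_on P (\<lambda>(x, t). w x t)" using cont continuous_on_subset by blast
    moreover have "continuous_on P (\<lambda>(x, t). \<psi> x t)"
      by (rule cont_\<psi>) (auto simp: P_def)
    ultimately have "continuous_on P (\<lambda>p. (\<lambda>(x, t). w x t) p + m * (\<lambda>(x, t). \<psi> x t) p)"
      by (intro continuous_intros)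
    then show "continuous_on P (\<lambda>(x, t). v x t)" by (simp add: v_def case_prod_beta)
    show "0 \<le> s" if "(y, s) \<in> S" for y s using that by (auto simp: S_def)
    show "0 \<le> v y s" if "(y, s) \<in> S" "(y, s) \<notin> D \<times> {0<..t}" for y s
    proof -
      have "0 \<le> w y s"
        using that initial[of y] lateral[of y s] frontier_D by (cases "s = 0") (auto simp: S_def)
      moreover have "0 \<le> \<psi> y s" using that by (intro \<psi>(3)) (auto simp: S_def)
      ultimately show ?thesis using \<open>m > 0\<close> by (simp add: v_def)
    qed
    show "0 \<le> v y s" if "(y, s) \<in> S" "(y, s) \<notin> P" for y s
    proof -
      have "1 < \<psi> y s" using that by (auto simp: S_def P_def)
      then have "m * 1 \<le> m * \<psi> y s" using \<open>m > 0\<close> by (intro mult_left_mono) auto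
      moreover have "- m \<le> w y s"
        using that initial[of y] lateral[of y s] lower[of y s] frontier_D \<open>m > 0\<close>
        by (cases "s = 0") (auto simp: S_def m_def)
      ultimately show ?thesis by (simp add: v_def)
    qed
    show "\<exists>e>0. \<forall>y' s'. dist y' y < e \<longrightarrow> s - e < s' \<longrightarrow> s' \<le> s \<longrightarrow> (y', s') \<in> S"
      if ys: "(y, s) \<in> D \<times> {0<..t}" for y s
    proof -
      obtain e where e: "e > 0" "ball y e \<subseteq> D" using D(1) ys open_contains_ball by blast
      have "(y', s') \<in> S" if "dist y' y < min e s" "s - min e s < s'" "s' \<le> s" for y' s'
      proof -
        have "y' \<in> D" using e that by (auto simp: dist_commute)
        then have "y' \<in> closure D" using closure_subset by blast
        then show ?thesis
          using that ys by (auto simp: S_def)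
      qed
      then show ?thesis
        using e(1) ys by (intro exI[of _ "min e s"]) auto
    qed
    show "\<exists>d\<ge>0. has_heat_defect v y s d" if "(y, s) \<in> D \<times> {0<..t}" for y s
      using has_heat_defect_add[OF super has_heat_defect_cmult[OF \<psi>(1)], of y s m] that
      by (intro exI[of _ 0]) (auto simp: v_def[abs_def])
    show "(x, t) \<in> S" using x t closure_subset by (auto simp: S_def)
  qed
  moreover have "m * \<psi> x t \<le> m * (\<epsilon> * t powr (- real CARD('n) / 2))"
    using \<psi>(5)[OF t] \<open>m > 0\<close> by (intro mult_left_mono) auto
  moreover have "m * (\<epsilon> * t powr (- real CARD('n) / 2)) = \<eta>"
    using \<open>m > 0\<close> t by (simp add: \<epsilon>_def)
  ultimately show "0 \<le> w x t + \<eta>" by (simp add: v_def)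
qed

section \<open>Lower bounds on an expanding ball\<close>

text \<open>
Here \<open>p\<close> is the squared radius at time \<open>t\<close> minus the squared distance to \<open>y\<close>. With \<open>N\<close> the dimension
and \<open>z = (norm (x - y))\<^sup>2\<close>, the heat operator applied to \<open>p + K * p\<^sup>2\<close> gives
\<open>(1 + 2 * K * p) * (\<beta> + 2 * N) - 8 * K * z\<close>. At \<open>p = 0\<close> the gradient term \<open>8 * K * z\<close> dominates, since
then \<open>z \<ge> \<rho>\<^sup>2\<close>; this is the choice of \<open>K\<close>. Inside, the remaining terms linear in \<open>p\<close> are absorbed
by the exponential decay in time; this is the choice of \<open>\<alpha>\<close>.
\<close>

lemma expanding_ball_subsolution:
  fixes y x :: "real ^ 'n"
  assumes "\<rho> > 0" "\<beta> \<ge> 0" "t1 \<le> t"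
    and K: "K = (\<beta> + 2 * real CARD('n)) / (8 * \<rho>\<^sup>2)"
    and \<alpha>: "\<alpha> = 2 * K * (\<beta> + 2 * real CARD('n)) + 8 * K"
    and p: "\<And>x t. p x t = \<rho>\<^sup>2 + \<beta> * (t - t1) - (norm (x - y))\<^sup>2"
    and "0 \<le> p x t"
  obtains d where "d \<le> 0"
    "has_heat_defect (\<lambda>x t. exp (- \<alpha> * (t - t1)) * (p x t + K * (p x t)\<^sup>2)) x t d"
proof -
  let ?N = "real CARD('n)"
  let ?E = "exp (- \<alpha> * (t - t1))"
  let ?P = "p x t"
  define a where "a = ?E * ((1 + 2 * K * ?P) * \<beta> - \<alpha> * (?P + K * ?P\<^sup>2))"
  define q where "q i = ?E * (8 * K * (x $ i - y $ i)\<^sup>2 - 2 * (1 + 2 * K * ?P))" for i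
  have "((\<lambda>t. exp (- \<alpha> * (t - t1)) * (p x t + K * (p x t)\<^sup>2)) has_real_derivative a) (at t)"
    unfolding p a_def by (auto intro!: derivative_eq_intros simp: algebra_simps power2_eq_square)
  moreover
  let ?g = "\<lambda>i s. ?E * (- 2 * (x $ i + s - y $ i)) * (1 + 2 * K * p (x + s *\<^sub>R axis i 1) t)"
  have line: "((\<lambda>s. p (x + s *\<^sub>R axis i 1) t) has_real_derivative - 2 * (x $ i + s - y $ i)) (at s)"
    for i s
    unfolding p using norm_line_derivative[of x i y s] by (auto intro!: DERIV_diff[OF DERIV_const, THEN DERIV_cong])
  have "((\<lambda>s. ?E * (p (x + s *\<^sub>R axis i 1) t + K * (p (x + s *\<^sub>R axis i 1) t)\<^sup>2))
      has_real_derivative ?g i s) (at s)" for i s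
    by (auto intro!: derivative_eq_intros line simp: algebra_simps)
  moreover have "(?g i has_real_derivative q i) (at 0)" for i
    unfolding q_def by (auto intro!: derivative_eq_intros line simp: algebra_simps power2_eq_square)
  ultimately have dfct: "has_heat_defect (\<lambda>x t. exp (- \<alpha> * (t - t1)) * (p x t + K * (p x t)\<^sup>2)) x t
      (a - (\<Sum>i\<in>UNIV. q i))"
    unfolding has_heat_defect_def by (intro exI[of _ a] exI[of _ ?g] exI[of _ q]) auto
  define z where "z = (norm (x - y))\<^sup>2"
  have z: "z = (\<Sum>i\<in>UNIV. (x $ i - y $ i)\<^sup>2)"
    by (simp add: z_def norm_vec_def L2_set_def sum_nonneg)
  have "(\<Sum>i\<in>UNIV. q i) = ?E * (8 * K * z - 2 * ?N * (1 + 2 * K * ?P))"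
    unfolding q_def z by (simp add: sum_subtractf flip: sum_distrib_left)
  then have eq: "a - (\<Sum>i\<in>UNIV. q i) =
      ?E * ((1 + 2 * K * ?P) * (\<beta> + 2 * ?N) - \<alpha> * (?P + K * ?P\<^sup>2) - 8 * K * z)"
    by (simp add: a_def algebra_simps)
  have "K > 0" using assms by (simp add: K add_nonneg_pos)
  have "8 * K * \<rho>\<^sup>2 = \<beta> + 2 * ?N" using \<open>\<rho> > 0\<close> by (simp add: K)
  moreover have "8 * K * \<rho>\<^sup>2 \<le> 8 * K * (z + ?P)"
    using \<open>K > 0\<close> assms by (intro mult_left_mono) (auto simp: z_def p)
  moreover have "0 \<le> \<alpha> * (K * ?P\<^sup>2)"
    using \<open>K > 0\<close> assms(2) by (auto simp: \<alpha> intro!: mult_nonneg_nonneg add_nonneg_nonneg)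
  moreover have "(1 + 2 * K * ?P) * (\<beta> + 2 * ?N) - \<alpha> * (?P + K * ?P\<^sup>2) - 8 * K * z
      = (\<beta> + 2 * ?N) - 8 * K * (z + ?P) - \<alpha> * (K * ?P\<^sup>2)"
    unfolding \<alpha> by (simp add: algebra_simps)
  ultimately have "(1 + 2 * K * ?P) * (\<beta> + 2 * ?N) - \<alpha> * (?P + K * ?P\<^sup>2) - 8 * K * z \<le> 0"
    by linarith
  then have "a - (\<Sum>i\<in>UNIV. q i) \<le> 0"
    unfolding eq by (simp add: mult_nonneg_nonpos)
  then show thesis using that dfct by blast
qed

text \<open>
Positivity on a small ball at time \<open>t1\<close> forces a lower bound on the large ball at time \<open>t2\<close>, by comparison
with a small multiple of the subsolution on the ball whose squared radius grows linearly from
\<open>\<rho>\<^sup>2\<close> to \<open>R\<^sup>2\<close>. The bound is linear in the distance to the large sphere, as a Hopf estimate needs.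
The subsolution vanishes on the moving sphere, so \<open>w\<close> may vanish on the large one.
\<close>

lemma expanding_ball_lower_bound:
  fixes w :: "real ^ 'n \<Rightarrow> real \<Rightarrow> real" and y :: "real ^ 'n"
  assumes "0 < \<rho>" "\<rho> \<le> R" "0 \<le> t1" "t1 < t2"
    and cont: "continuous_on (cball y R \<times> {t1..t2}) (\<lambda>(x, t). w x t)"
    and nonneg: "\<And>x t. x \<in> cball y R \<Longrightarrow> t1 \<le> t \<Longrightarrow> t \<le> t2 \<Longrightarrow> 0 \<le> w x t"
    and initial: "\<And>x. x \<in> cball y \<rho> \<Longrightarrow> 0 < w x t1"
    and super: "\<And>x t. x \<in> ball y R \<Longrightarrow> t1 < t \<Longrightarrow> t \<le> t2 \<Longrightarrow> has_heat_defect w x t 0"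
  obtains c where "c > 0" "\<And>x. x \<in> cball y R \<Longrightarrow> c * (R\<^sup>2 - (norm (x - y))\<^sup>2) \<le> w x t2"
proof -
  define \<beta> where "\<beta> = (R\<^sup>2 - \<rho>\<^sup>2) / (t2 - t1)"
  have "\<beta> \<ge> 0" using assms by (simp add: \<beta>_def power_mono)
  define K where "K = (\<beta> + 2 * real CARD('n)) / (8 * \<rho>\<^sup>2)"
  define \<alpha> where "\<alpha> = 2 * K * (\<beta> + 2 * real CARD('n)) + 8 * K"
  define p where "p x t = \<rho>\<^sup>2 + \<beta> * (t - t1) - (norm (x - y))\<^sup>2" for x t
  define \<phi> where "\<phi> x t = exp (- \<alpha> * (t - t1)) * (p x t + K * (p x t)\<^sup>2)" for x t
  have "K \<ge> 0" using \<open>\<beta> \<ge> 0\<close> by (simp add: K_def)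
  have p_end: "p x t2 = R\<^sup>2 - (norm (x - y))\<^sup>2" for x
    using assms by (simp add: p_def \<beta>_def)
  have p_mono: "p x t \<le> p x t2" if "t \<le> t2" for x t
    using that \<open>\<beta> \<ge> 0\<close> by (simp add: p_def mult_left_mono)
  have in_cball: "x \<in> cball y R" if "0 \<le> p x t" "t \<le> t2" for x t
    using order_trans[OF that(1) p_mono[OF that(2)]] assms(1,2)
    by (simp add: p_end dist_norm norm_minus_commute abs_le_square_iff[symmetric])
  have in_ball: "x \<in> ball y R" if "0 < p x t" "t \<le> t2" for x t
    using less_le_trans[OF that(1) p_mono[OF that(2)]] assms(1,2)
    by (simp add: p_end dist_norm norm_minus_commute power_less_imp_less_base)
  have "continuous_on (cball y \<rho>) (\<lambda>x. (\<lambda>(x, t). w x t) (x, t1))"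
    using assms by (intro continuous_on_compose2[OF cont] continuous_intros) auto
  then have "\<exists>z\<in>cball y \<rho>. \<forall>x\<in>cball y \<rho>. w z t1 \<le> w x t1"
    using \<open>0 < \<rho>\<close> by (intro continuous_attains_inf) auto
  then obtain m where "m > 0" and m: "\<And>x. x \<in> cball y \<rho> \<Longrightarrow> m \<le> w x t1"
    using initial by blast
  \<comment> \<open>The denominator is the largest value of \<open>\<phi>\<close> at time \<open>t1\<close>, attained at the centre.\<close>
  define \<epsilon> where "\<epsilon> = m / (\<rho>\<^sup>2 + K * (\<rho>\<^sup>2)\<^sup>2)"
  have den: "0 < \<rho>\<^sup>2 + K * (\<rho>\<^sup>2)\<^sup>2"
    using \<open>0 < \<rho>\<close> \<open>K \<ge> 0\<close> by (simp add: add_pos_nonneg)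
  have "\<epsilon> > 0" using den \<open>m > 0\<close> by (simp add: \<epsilon>_def)
  define v where "v x t = w x t + (- \<epsilon>) * \<phi> x t" for x t
  define S where "S = {q \<in> UNIV \<times> {t1..t2}. 0 \<le> (\<lambda>(x, t). p x t) q}"
  define I where "I = {(x, t). t1 < t \<and> t \<le> t2 \<and> 0 < p x t}"
  have cont_p: "continuous_on A (\<lambda>(x, t). p x t)" for A
    unfolding p_def case_prod_beta by (intro continuous_intros)
  have v_nonneg: "0 \<le> v x t" if xt: "(x, t) \<in> S" for x t
  proof (rule weak_minimum_principle[where v = v and x = x and t = t and P = S and S = S and I = I, OF _ _ _ _ _ _ _ _ xt])
    show "S \<subseteq> S" by simp
    have S_sub: "S \<subseteq> cball y R \<times> {t1..t2}" using in_cball unfolding S_def by auto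
    moreover have "closed S"
      unfolding S_def
      by (intro continuous_on_closed_Collect_le cont_p continuous_intros closed_Times closed_UNIV closed_atLeastAtMost)
    ultimately show "compact S"
      using compact_Int_closed[of "cball y R \<times> {t1..t2}" S] compact_Times[OF compact_cball compact_Icc]
      by (metis inf.absorb_iff2)
    have "continuous_on S (\<lambda>q. (\<lambda>(x, t). w x t) q + (- \<epsilon>) * (exp (- \<alpha> * (snd q - t1)) *
        ((\<lambda>(x, t). p x t) q + K * ((\<lambda>(x, t). p x t) q)\<^sup>2)))"
      by (intro continuous_intros continuous_on_subset[OF cont S_sub] cont_p)
    then show "continuous_on S (\<lambda>(x, t). v x t)" by (simp add: v_def \<phi>_def case_prod_beta)
    show "0 \<le> s" if "(z, s) \<in> S" for z s using that \<open>0 \<le> t1\<close> by (auto simp: S_def)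
    show "0 \<le> v z s" if "(z, s) \<in> S" "(z, s) \<notin> S" for z s using that by simp
    show "0 \<le> v z s" if zs: "(z, s) \<in> S" "(z, s) \<notin> I" for z s
    proof (cases "s = t1")
      case True
      have p0: "0 \<le> p z t1" using zs True by (auto simp: S_def)
      then have "z \<in> cball y \<rho>"
        using \<open>0 < \<rho>\<close> by (simp add: p_def dist_norm norm_minus_commute abs_le_square_iff[symmetric])
      then have "m \<le> w z t1" using m by blast
      have "p z t1 \<le> \<rho>\<^sup>2" by (simp add: p_def)
      moreover from this have "K * (p z t1)\<^sup>2 \<le> K * (\<rho>\<^sup>2)\<^sup>2"
        using p0 \<open>K \<ge> 0\<close> by (intro mult_left_mono power_mono)
      ultimately have "\<phi> z t1 \<le> \<rho>\<^sup>2 + K * (\<rho>\<^sup>2)\<^sup>2" by (simp add: \<phi>_def)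
      then have "\<epsilon> * \<phi> z t1 \<le> \<epsilon> * (\<rho>\<^sup>2 + K * (\<rho>\<^sup>2)\<^sup>2)"
        using \<open>\<epsilon> > 0\<close> by (intro mult_left_mono) auto
      also have "\<dots> = m" using den by (simp add: \<epsilon>_def)
      finally show ?thesis using \<open>m \<le> w z t1\<close> True by (simp add: v_def)
    next
      case False
      then have "p z s = 0" using zs by (auto simp: S_def I_def)
      then have "v z s = w z s" by (simp add: v_def \<phi>_def)
      moreover have "z \<in> cball y R" "t1 \<le> s" "s \<le> t2" using zs S_sub by auto
      ultimately show ?thesis using nonneg by simp
    qed
    show "\<exists>e>0. \<forall>x' t'. dist x' z < e \<longrightarrow> s - e < t' \<longrightarrow> t' \<le> s \<longrightarrow> (x', t') \<in> S"
      if zs: "(z, s) \<in> I" for z s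
    proof -
      have "open {q. t1 < snd q \<and> 0 < (\<lambda>(x, t). p x t) q}"
        by (intro open_Collect_conj open_Collect_less continuous_intros cont_p)
      moreover have "(z, s) \<in> {q. t1 < snd q \<and> 0 < (\<lambda>(x, t). p x t) q}"
        using zs by (auto simp: I_def)
      ultimately obtain e where "e > 0" and
          e: "ball (z, s) e \<subseteq> {q. t1 < snd q \<and> 0 < (\<lambda>(x, t). p x t) q}"
        using open_contains_ball by blast
      have "(x', t') \<in> S" if "dist x' z < e / 2" "s - e / 2 < t'" "t' \<le> s" for x' t'
      proof -
        have "dist (z, s) (x', t') \<le> dist z x' + dist s t'"
          unfolding dist_Pair_Pair by (rule sqrt_sum_squares_le_sum) auto
        also have "\<dots> < e" using that by (simp add: dist_commute dist_real_def)
        finally have "(x', t') \<in> ball (z, s) e" by simp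
        then show ?thesis using e that zs by (fastforce simp: S_def I_def)
      qed
      then show ?thesis using \<open>e > 0\<close> by (intro exI[of _ "e / 2"]) auto
    qed
    show "\<exists>d\<ge>0. has_heat_defect v z s d" if zs: "(z, s) \<in> I" for z s
    proof -
      have *: "t1 < s" "s \<le> t2" "0 < p z s" using zs by (auto simp: I_def)
      obtain d where "d \<le> 0" "has_heat_defect \<phi> z s d"
        using expanding_ball_subsolution[OF \<open>0 < \<rho>\<close> \<open>0 \<le> \<beta>\<close> less_imp_le[OF *(1)] K_def \<alpha>_def
          p_def less_imp_le[OF *(3)]] unfolding \<phi>_def[abs_def] by blast
      moreover have "has_heat_defect w z s 0" using super in_ball * by blast
      ultimately have "has_heat_defect v z s (0 + (- \<epsilon>) * d)"
        unfolding v_def[abs_def] by (intro has_heat_defect_add has_heat_defect_cmult)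
      moreover have "0 \<le> 0 + (- \<epsilon>) * d" using \<open>d \<le> 0\<close> \<open>\<epsilon> > 0\<close> by (simp add: mult_nonneg_nonpos)
      ultimately show ?thesis by blast
    qed
  qed
  define c where "c = \<epsilon> * exp (- \<alpha> * (t2 - t1))"
  have "c > 0" using \<open>\<epsilon> > 0\<close> by (simp add: c_def)
  moreover have "c * (R\<^sup>2 - (norm (x - y))\<^sup>2) \<le> w x t2" if "x \<in> cball y R" for x
  proof -
    have p0: "0 \<le> p x t2"
      using that by (simp add: p_end dist_norm norm_minus_commute power_mono)
    then have "0 \<le> v x t2" using v_nonneg \<open>t1 < t2\<close> by (simp add: S_def)
    moreover have "c * p x t2 \<le> \<epsilon> * \<phi> x t2"
      unfolding c_def \<phi>_def mult.assoc
      using p0 \<open>\<epsilon> > 0\<close> \<open>K \<ge> 0\<close> by (intro mult_left_mono) auto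
    ultimately show ?thesis by (simp add: v_def p_end)
  qed
  ultimately show thesis using that by blast
qed

section \<open>Classical solutions under isometries\<close>

lemma has_derivative_along_line:
  fixes F :: "'a::real_normed_vector \<Rightarrow> real"
  assumes "(F has_derivative F') (at (a + s *\<^sub>R h))"
  shows "((\<lambda>s. F (a + s *\<^sub>R h)) has_real_derivative F' h) (at s)"
proof -
  have "((\<lambda>s. a + s *\<^sub>R h) has_derivative (\<lambda>r. r *\<^sub>R h)) (at s)"
    by (auto intro!: derivative_eq_intros)
  from has_derivative_compose[OF this assms]
  have "((\<lambda>s. F (a + s *\<^sub>R h)) has_derivative (\<lambda>r. F' (r *\<^sub>R h))) (at s)" .
  moreover have "F' (r *\<^sub>R h) = F' h * r" for r
    using linear_scale[OF has_derivative_linear[OF assms]] by simp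
  ultimately show ?thesis by (simp add: has_field_derivative_def)
qed

text \<open>
The Laplacian is the trace of the Hessian, so it may be computed along any orthonormal frame \<open>f\<close>. The map
\<open>A\<close> sends coordinate lines through \<open>x\<close> to lines in the directions of \<open>f\<close>; it is used with the identity
and with the reflection. Joint continuity of the second partial derivatives enters through the chain rule
for the first ones.
\<close>

lemma heat_solution_defect:
  fixes \<Omega> :: "(real ^ 'n) set" and f :: "'n \<Rightarrow> real ^ 'n"
  assumes sol: "heat_solution \<Omega> u" and "open \<Omega>" and x: "A x \<in> \<Omega>" and t: "0 < t"
    and A: "\<And>i s. A (x + s *\<^sub>R axis i 1) = A x + s *\<^sub>R f i"
    and orth: "\<And>j k. (\<Sum>i\<in>UNIV. f i $ j * f i $ k) = (if j = k then 1 else 0)"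
  shows "has_heat_defect (\<lambda>x t. u (A x) t) x t 0"
proof -
  define U where "U y = u y t" for y
  have C21: "C21 \<Omega> u" using sol by (simp add: heat_solution_def)
  have slice: "continuous_on \<Omega> (\<lambda>y. F (y, t))"
    if "continuous_on (\<Omega> \<times> {0<..}) F" for F :: "(real ^ 'n) \<times> real \<Rightarrow> real"
    using t by (intro continuous_on_compose2[OF that] continuous_intros) auto
  have U1: "partial_differentiable i U y" if "y \<in> \<Omega>" for i y
    using C21 t that unfolding C21_def U_def[abs_def] by blast
  have U2: "partial_differentiable k (partial_deriv i U) y" if "y \<in> \<Omega>" for i k y
    using C21 t that unfolding C21_def U_def[abs_def] by blast
  have "continuous_on (\<Omega> \<times> {0<..}) (\<lambda>(x, t). partial_deriv i (\<lambda>y. u y t) x)" for i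
    using C21 unfolding C21_def by blast
  then have U3: "continuous_on \<Omega> (partial_deriv i U)" for i
    using slice unfolding U_def[abs_def] by fastforce
  have "continuous_on (\<Omega> \<times> {0<..}) (\<lambda>(x, t). partial_deriv k (partial_deriv i (\<lambda>y. u y t)) x)" for i k
    using C21 unfolding C21_def by blast
  then have U4: "continuous_on \<Omega> (partial_deriv k (partial_deriv i U))" for i k
    using slice unfolding U_def[abs_def] by fastforce
  note D1 = has_derivative_of_continuous_partials[OF \<open>open \<Omega>\<close> _ U1 U3]
  note D2 = has_derivative_of_continuous_partials[OF \<open>open \<Omega>\<close> _ U2 U4]
  define p where "p i s = (\<Sum>j\<in>UNIV. f i $ j * partial_deriv j U (A x + s *\<^sub>R f i))" for i s
  define q where "q i = (\<Sum>j\<in>UNIV. f i $ j *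
      (\<Sum>k\<in>UNIV. f i $ k * partial_deriv k (partial_deriv j U) (A x)))" for i
  have "u (A x) differentiable (at t)" using C21 x t by (simp add: C21_def)
  then have "(u (A x) has_real_derivative deriv (u (A x)) t) (at t)"
    by (simp add: DERIV_deriv_iff_real_differentiable)
  moreover have "deriv (u (A x)) t = laplacian U (A x)"
    using sol x t by (simp add: heat_solution_def U_def[abs_def])
  moreover have "\<forall>\<^sub>F s in nhds 0.
      ((\<lambda>s. U (A (x + s *\<^sub>R axis i 1))) has_real_derivative p i s) (at s)" for i
  proof -
    have "continuous_on UNIV (\<lambda>s. A x + s *\<^sub>R f i)" by (intro continuous_intros)
    then have "open ((\<lambda>s. A x + s *\<^sub>R f i) -` \<Omega>)"
      using \<open>open \<Omega>\<close> by (simp add: open_vimage continuous_on_eq_continuous_at)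
    then have "\<forall>\<^sub>F s in nhds 0. s \<in> (\<lambda>s. A x + s *\<^sub>R f i) -` \<Omega>"
      using x by (intro eventually_nhds_in_open) auto
    then show ?thesis
    proof eventually_elim
      case (elim s)
      then show ?case
        using has_derivative_along_line[OF D1, of "A x" s "f i"] by (simp add: p_def A)
    qed
  qed
  moreover have "(p i has_real_derivative q i) (at 0)" for i
  proof -
    have "((\<lambda>s. partial_deriv j U (A x + s *\<^sub>R f i)) has_real_derivative
        (\<Sum>k\<in>UNIV. f i $ k * partial_deriv k (partial_deriv j U) (A x))) (at 0)" for j
      using has_derivative_along_line[OF D2, of "A x" 0 "f i"] x by simp
    then show ?thesis
      unfolding p_def[abs_def] q_def by (intro DERIV_sum DERIV_cmult)
  qed
  moreover have "(\<Sum>i\<in>UNIV. q i) = laplacian U (A x)"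
  proof -
    have "(\<Sum>i\<in>UNIV. q i) = (\<Sum>i\<in>UNIV. \<Sum>j\<in>UNIV. \<Sum>k\<in>UNIV.
        (f i $ j * f i $ k) * partial_deriv k (partial_deriv j U) (A x))"
      by (simp add: q_def sum_distrib_left mult.assoc)
    also have "\<dots> = (\<Sum>j\<in>UNIV. \<Sum>i\<in>UNIV. \<Sum>k\<in>UNIV.
        (f i $ j * f i $ k) * partial_deriv k (partial_deriv j U) (A x))"
      by (rule sum.swap)
    also have "\<dots> = (\<Sum>j\<in>UNIV. \<Sum>k\<in>UNIV. \<Sum>i\<in>UNIV.
        (f i $ j * f i $ k) * partial_deriv k (partial_deriv j U) (A x))"
      by (intro sum.cong sum.swap refl)
    also have "\<dots> = (\<Sum>j\<in>UNIV. \<Sum>k\<in>UNIV.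
        (if j = k then 1 else 0) * partial_deriv k (partial_deriv j U) (A x))"
      by (simp only: sum_distrib_right[symmetric] orth)
    also have "\<dots> = laplacian U (A x)"
      by (simp add: laplacian_def if_distrib[of "\<lambda>c. c * _"] cong: if_cong)
    finally show ?thesis .
  qed
  ultimately show ?thesis
    unfolding has_heat_defect_def U_def
    by (intro exI[of _ "deriv (u (A x)) t"] exI[of _ p] exI[of _ q]) auto
qed

section \<open>Lipschitz boundaries are Lebesgue null\<close>

text \<open>
In a chart the boundary lies on the graph, which is the image of a hyperplane under a Lipschitz map.
\<close>

lemma negligible_frontier_lipschitz_boundary:
  fixes \<Omega> :: "(real ^ 'n) set"
  assumes "open \<Omega>" "lipschitz_boundary \<Omega>"
  shows "negligible (frontier \<Omega>)"
  unfolding locally_negligible_alt[of "frontier \<Omega>"]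
proof
  fix p assume "p \<in> frontier \<Omega>"
  then obtain U \<nu> and g :: "real ^ 'n \<Rightarrow> real" and L where U: "open U" "p \<in> U" and \<nu>: "norm \<nu> = 1"
    and g: "L-lipschitz_on {y. y \<bullet> \<nu> = 0} g"
    and epi: "\<Omega> \<inter> U = {x \<in> U. x \<bullet> \<nu> > g (x - (x \<bullet> \<nu>) *\<^sub>R \<nu>)}"
    using assms(2) unfolding lipschitz_boundary_def by meson
  let ?H = "{y. y \<bullet> \<nu> = 0}"
  let ?pr = "\<lambda>x. x - (x \<bullet> \<nu>) *\<^sub>R \<nu>"
  have \<nu>\<nu>: "\<nu> \<bullet> \<nu> = 1" using \<nu> by (simp add: norm_eq_1)
  then have pr: "?pr x \<in> ?H" for x by (simp add: inner_diff_left)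
  define f where "f y = y + g y *\<^sub>R \<nu>" for y
  have "negligible ?H"
  proof -
    have "\<nu> \<noteq> 0" using \<nu> by auto
    then have "negligible {y. \<nu> \<bullet> y = 0}" by (intro negligible_hyperplane) simp
    then show ?thesis by (simp add: inner_commute)
  qed
  then have "negligible (f ` ?H)"
  proof (rule negligible_locally_Lipschitz_image[OF order_refl])
    fix x assume x: "x \<in> ?H"
    have "norm (f y - f x) \<le> (1 + L) * norm (y - x)" if y: "y \<in> ?H" for y
    proof -
      have "f y - f x = (y - x) + (g y - g x) *\<^sub>R \<nu>" by (simp add: f_def algebra_simps)
      then have "norm (f y - f x) \<le> norm (y - x) + \<bar>g y - g x\<bar>"
        using norm_triangle_ineq[of "y - x" "(g y - g x) *\<^sub>R \<nu>"] \<nu> by simp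
      moreover have "\<bar>g y - g x\<bar> \<le> L * norm (y - x)"
        using lipschitz_onD[OF g y x] by (simp add: dist_norm)
      ultimately show ?thesis by (simp add: algebra_simps)
    qed
    then show "\<exists>T B. open T \<and> x \<in> T \<and> (\<forall>y\<in>?H \<inter> T. norm (f y - f x) \<le> B * norm (y - x))"
      by (intro exI[of _ UNIV] exI[of _ "1 + L"]) auto
  qed
  moreover have "frontier \<Omega> \<inter> U \<subseteq> f ` ?H"
  proof
    fix x assume x: "x \<in> frontier \<Omega> \<inter> U"
    \<comment> \<open>Strictly above the graph points are in \<open>\<Omega>\<close>, which is open; strictly below they have a
      neighbourhood disjoint from \<open>\<Omega>\<close>.\<close>
    have cont: "continuous_on UNIV (\<lambda>x. g (?pr x))"
      using pr by (intro continuous_on_compose2[OF lipschitz_on_continuous_on[OF g]] continuous_intros) auto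
    have "x \<notin> \<Omega>" using x \<open>open \<Omega>\<close> frontier_disjoint_eq by blast
    then have "x \<bullet> \<nu> \<le> g (?pr x)" using epi x by force
    moreover have "\<not> x \<bullet> \<nu> < g (?pr x)"
    proof
      assume "x \<bullet> \<nu> < g (?pr x)"
      moreover have "open (U \<inter> {x. x \<bullet> \<nu> < g (?pr x)})"
        using U cont by (intro open_Int open_Collect_less continuous_intros)
      moreover have "U \<inter> {x. x \<bullet> \<nu> < g (?pr x)} \<inter> \<Omega> = {}" using epi by force
      ultimately have "U \<inter> {x. x \<bullet> \<nu> < g (?pr x)} \<inter> closure \<Omega> = {}"
        using open_Int_closure_eq_empty by blast
      then show False using x \<open>x \<bullet> \<nu> < g (?pr x)\<close> by (auto simp: frontier_def)
    qed
    ultimately have "x = f (?pr x)" by (simp add: f_def)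
    then show "x \<in> f ` ?H" using pr by blast
  qed
  ultimately have "negligible (frontier \<Omega> \<inter> U)" using negligible_subset by blast
  moreover have "openin (top_of_set (frontier \<Omega>)) (frontier \<Omega> \<inter> U)"
    using U(1) by (rule openin_open_Int)
  ultimately show "\<exists>V. openin (top_of_set (frontier \<Omega>)) V \<and> p \<in> V \<and> negligible V"
    using U(2) \<open>p \<in> frontier \<Omega>\<close> by blast
qed

section \<open>The reflection in a hyperplane\<close>

lemma refl_hyp_inner: "norm \<omega> = 1 \<Longrightarrow> refl_hyp \<mu> \<omega> x \<bullet> \<omega> = 2 * \<mu> - x \<bullet> \<omega>"
  by (simp add: refl_hyp_def inner_diff_left inner_add_left norm_eq_1)

lemma refl_hyp_involution: "norm \<omega> = 1 \<Longrightarrow> refl_hyp \<mu> \<omega> (refl_hyp \<mu> \<omega> x) = x"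
  unfolding refl_hyp_def[of _ _ "refl_hyp \<mu> \<omega> x"] refl_hyp_inner
  by (simp add: refl_hyp_def algebra_simps flip: scaleR_add_left)

lemma refl_hyp_fixed: "x \<bullet> \<omega> = \<mu> \<Longrightarrow> refl_hyp \<mu> \<omega> x = x"
  by (simp add: refl_hyp_def)

lemma refl_hyp_dist:
  assumes "norm \<omega> = 1"
  shows "dist (refl_hyp \<mu> \<omega> x) (refl_hyp \<mu> \<omega> y) = dist x y"
proof -
  define z where "z = x - y"
  have "refl_hyp \<mu> \<omega> x - refl_hyp \<mu> \<omega> y = z - (2 * (z \<bullet> \<omega>)) *\<^sub>R \<omega>"
    by (simp add: refl_hyp_def z_def inner_diff_left algebra_simps)
  moreover have "(norm (z - (2 * (z \<bullet> \<omega>)) *\<^sub>R \<omega>))\<^sup>2 = (norm z)\<^sup>2"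
    unfolding power2_norm_eq_inner using assms
    by (simp add: inner_diff_left inner_diff_right norm_eq_1 inner_commute power2_eq_square)
  ultimately show ?thesis by (simp add: dist_norm z_def)
qed

lemma continuous_on_refl_hyp: "continuous_on S (refl_hyp \<mu> \<omega>)"
  unfolding refl_hyp_def[abs_def] by (intro continuous_intros)

lemma refl_hyp_ball:
  "norm \<omega> = 1 \<Longrightarrow> refl_hyp \<mu> \<omega> x \<in> ball (refl_hyp \<mu> \<omega> a) e \<longleftrightarrow> x \<in> ball a e"
  by (simp add: refl_hyp_dist)

lemma reflected_basis_orthonormal:
  fixes \<omega> :: "real ^ 'n"
  assumes "norm \<omega> = 1"
  shows "(\<Sum>i\<in>UNIV. (axis i 1 - (2 * \<omega> $ i) *\<^sub>R \<omega>) $ j * (axis i 1 - (2 * \<omega> $ i) *\<^sub>R \<omega>) $ k)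
           = (if j = k then 1 else 0)"
proof -
  have one: "(\<Sum>i\<in>UNIV. \<omega> $ i * \<omega> $ i) = 1"
    using assms by (simp add: norm_eq_1 inner_vec_def)
  have "(axis i 1 - (2 * \<omega> $ i) *\<^sub>R \<omega>) $ j * (axis i 1 - (2 * \<omega> $ i) *\<^sub>R \<omega>) $ k =
      (if i = j then (if j = k then 1 else 0) else 0) - (if i = j then 2 * \<omega> $ i * \<omega> $ k else 0)
      - (if i = k then 2 * \<omega> $ i * \<omega> $ j else 0) + 4 * \<omega> $ j * \<omega> $ k * (\<omega> $ i * \<omega> $ i)" for i
    by (simp add: axis_def algebra_simps)
  then show ?thesis
    by (simp add: sum.distrib sum_subtractf one flip: sum_distrib_left)
qed

section \<open>The reflected difference on the cap\<close>

lemma closure_disjoint_from_open: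
  assumes "open V" "x \<in> V" "V \<inter> S = {}" shows "x \<notin> closure S"
  using open_Int_closure_eq_empty[OF assms(1)] assms by blast

locale reflected_heat_flow =
  fixes \<Omega> :: "(real ^ 'n) set" and \<omega> :: "real ^ 'n" and \<mu> :: real
    and u :: "real ^ 'n \<Rightarrow> real \<Rightarrow> real"
  assumes domain: "bounded_domain \<Omega>"
    and lipschitz: "lipschitz_boundary \<Omega>"
    and unit: "norm \<omega> = 1"
    and reflects_into: "refl_hyp \<mu> \<omega> ` (\<Omega> \<inter> upper_halfspace \<mu> \<omega>) \<subseteq> \<Omega>"
    and solution: "heat_solution \<Omega> u"
begin

abbreviation T :: "real ^ 'n \<Rightarrow> real ^ 'n" where "T \<equiv> refl_hyp \<mu> \<omega>"

definition cap :: "(real ^ 'n) set" where "cap = \<Omega> \<inter> upper_halfspace \<mu> \<omega>"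

definition w :: "real ^ 'n \<Rightarrow> real \<Rightarrow> real" where "w x t = u (T x) t - u x t"

lemma open_domain: "open \<Omega>"
  using domain by (simp add: bounded_domain_def)

lemma mem_cap: "x \<in> cap \<longleftrightarrow> x \<in> \<Omega> \<and> \<mu> < x \<bullet> \<omega>"
  by (simp add: cap_def upper_halfspace_def)

lemma open_cap: "open cap"
proof -
  have "open {x. \<mu> < x \<bullet> \<omega>}" by (intro open_Collect_less continuous_intros)
  then show ?thesis unfolding cap_def upper_halfspace_def using open_domain by blast
qed

lemma reflection_in_domain: "x \<in> cap \<Longrightarrow> T x \<in> \<Omega>"
  using reflects_into by (auto simp: cap_def)

lemma closure_cap:
  assumes "x \<in> closure cap"
  shows "x \<in> closure \<Omega>" "T x \<in> closure \<Omega>" "\<mu> \<le> x \<bullet> \<omega>"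
proof -
  show "x \<in> closure \<Omega>" using assms closure_mono[of cap \<Omega>] mem_cap by blast
  have "T ` closure cap \<subseteq> closure \<Omega>"
    using reflection_in_domain closure_subset
    by (intro image_closure_subset continuous_on_refl_hyp closed_closure) blast
  then show "T x \<in> closure \<Omega>" using assms by blast
  have "closed {x. \<mu> \<le> x \<bullet> \<omega>}" by (intro closed_Collect_le continuous_intros)
  moreover have "cap \<subseteq> {x. \<mu> \<le> x \<bullet> \<omega>}" using mem_cap by auto
  ultimately show "\<mu> \<le> x \<bullet> \<omega>" using assms closure_minimal by blast
qed

lemma closure_domain_cases: "x \<in> closure \<Omega> \<Longrightarrow> x \<in> \<Omega> \<or> x \<in> frontier \<Omega>"
  using closure_Un_frontier by blast

lemma solution_continuous:
  "continuous_on (closure \<Omega> \<times> {0..} - frontier \<Omega> \<times> {0}) (\<lambda>(x, t). u x t)"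
  using solution by (simp add: heat_solution_def)

lemma solution_bound:
  obtains M where "\<And>x t. x \<in> \<Omega> \<Longrightarrow> 0 < t \<Longrightarrow> \<bar>u x t\<bar> \<le> M"
proof -
  have "bounded ((\<lambda>(x, t). u x t) ` (\<Omega> \<times> {0<..}))"
    using solution by (simp add: heat_solution_def)
  then obtain M where "\<forall>z \<in> (\<lambda>(x, t). u x t) ` (\<Omega> \<times> {0<..}). norm z \<le> M"
    unfolding bounded_iff by blast
  then show thesis using that by force
qed

lemma solution_defect: "x \<in> \<Omega> \<Longrightarrow> 0 < t \<Longrightarrow> has_heat_defect u x t 0"
  using heat_solution_defect[OF solution open_domain, of "\<lambda>x. x" x t "\<lambda>i. axis i 1"]
  by (simp add: axis_def if_distrib[of "\<lambda>c. c * _"] cong: if_cong)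

lemma solution_lateral: "x \<in> frontier \<Omega> \<Longrightarrow> 0 < t \<Longrightarrow> u x t = 0"
  and solution_initial: "x \<in> \<Omega> \<Longrightarrow> u x 0 = 1"
  using solution by (simp_all add: heat_solution_def)

lemma solution_nonneg:
  assumes "x \<in> closure \<Omega>" "0 < t"
  shows "0 \<le> u x t"
proof (cases "x \<in> \<Omega>")
  case True
  obtain M where M: "\<And>x t. x \<in> \<Omega> \<Longrightarrow> 0 < t \<Longrightarrow> \<bar>u x t\<bar> \<le> M" by (rule solution_bound) blast
  show ?thesis
  proof (rule minimum_principle_off_corner[OF open_domain _ _ solution_continuous _ _ _ _ True assms(2)])
    show "bounded \<Omega>" using domain by (simp add: bounded_domain_def)
    show "negligible (frontier \<Omega>)"
      using negligible_frontier_lipschitz_boundary[OF open_domain lipschitz] .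
    show "- M \<le> u y s" if "y \<in> \<Omega>" "0 < s" for y s using M[OF that] by linarith
  qed (simp_all add: solution_initial solution_lateral solution_defect)
next
  case False
  then show ?thesis using assms closure_domain_cases solution_lateral by fastforce
qed

text \<open>
The initial value 1 is positive on a whole ball around \<open>x\<close>, so the expanding-ball estimate applies from
time 0 with a ball that does not expand.
\<close>

lemma solution_pos:
  assumes "x \<in> \<Omega>" "0 < t"
  shows "0 < u x t"
proof -
  obtain R where R: "0 < R" "cball x R \<subseteq> \<Omega>" using assms(1) open_domain open_contains_cball by blast
  have "cball x R \<times> {0..t} \<subseteq> closure \<Omega> \<times> {0..} - frontier \<Omega> \<times> {0}"
    using R(2) closure_subset[of \<Omega>] open_domain frontier_disjoint_eq[of \<Omega>] by fastforce
  then have cont: "continuous_on (cball x R \<times> {0..t}) (\<lambda>(x, t). u x t)"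
    using solution_continuous continuous_on_subset by blast
  have nonneg: "0 \<le> u y s" if "y \<in> cball x R" "0 \<le> s" for y s
    using that R(2) solution_nonneg[of y s] solution_initial[of y] closure_subset[of \<Omega>]
    by (cases "s = 0") force+
  obtain c where "c > 0" "\<And>y. y \<in> cball x R \<Longrightarrow> c * (R\<^sup>2 - (norm (y - x))\<^sup>2) \<le> u y t"
  proof (rule expanding_ball_lower_bound[OF R(1) order_refl order_refl assms(2) cont])
    show "0 < u y 0" if "y \<in> cball x R" for y using that R(2) solution_initial by fastforce
    show "has_heat_defect u y s 0" if "y \<in> ball x R" "0 < s" for y s
      using that R(2) ball_subset_cball by (intro solution_defect) blast+
  qed (use nonneg in auto)
  from this(2)[of x] \<open>c > 0\<close> R(1) show ?thesis
    by (smt (verit) centre_in_cball diff_self mult_pos_pos norm_zero zero_less_power zero_power2)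
qed

lemma w_defect:
  assumes "x \<in> cap" "0 < t"
  shows "has_heat_defect w x t 0"
proof -
  have affine: "T (y + s *\<^sub>R axis i 1) = T y + s *\<^sub>R (axis i 1 - (2 * \<omega> $ i) *\<^sub>R \<omega>)" for y s i
    by (simp add: refl_hyp_def inner_add_left inner_axis' algebra_simps)
  have "has_heat_defect (\<lambda>x t. u (T x) t) x t 0"
    using heat_solution_defect[OF solution open_domain reflection_in_domain[OF assms(1)] assms(2)
      affine reflected_basis_orthonormal[OF unit]] .
  moreover have "has_heat_defect (\<lambda>x t. (-1) * u x t) x t ((-1) * 0)"
    using assms by (intro has_heat_defect_cmult solution_defect) (auto simp: mem_cap)
  ultimately have "has_heat_defect (\<lambda>x t. u (T x) t + (-1) * u x t) x t (0 + (-1) * 0)"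
    by (rule has_heat_defect_add)
  then show ?thesis by (simp add: w_def[abs_def])
qed

text \<open>
The singular points of \<open>w\<close> at time 0 are the boundary points of \<open>\<Omega>\<close> and their mirror images; in the
closure of the cap both kinds lie on the frontier of the cap.
\<close>

lemma w_continuous:
  "continuous_on (closure cap \<times> {0..} - frontier cap \<times> {0}) (\<lambda>(x, t). w x t)"
proof -
  let ?A = "closure cap \<times> {0..} - frontier cap \<times> {0 :: real}"
  let ?B = "closure \<Omega> \<times> {0..} - frontier \<Omega> \<times> {0 :: real}"
  have not_frontier: "z \<notin> frontier \<Omega>" if "z \<in> \<Omega>" for z
    using that open_domain frontier_disjoint_eq by blast
  have in_cap: "x \<in> cap" if "x \<in> closure cap" "x \<notin> frontier cap" for x
    using that closure_Un_frontier by blast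
  have sub: "?A \<subseteq> ?B" "(\<lambda>p. (T (fst p), snd p)) ` ?A \<subseteq> ?B"
    using closure_cap in_cap not_frontier reflection_in_domain mem_cap by fastforce+
  have "continuous_on ?A (\<lambda>p. (T (fst p), snd p))"
    by (intro continuous_on_Pair continuous_on_compose2[OF continuous_on_refl_hyp[of UNIV]] continuous_intros) auto
  from continuous_on_compose2[OF solution_continuous this sub(2)]
    continuous_on_subset[OF solution_continuous sub(1)]
  have "continuous_on ?A (\<lambda>p. (\<lambda>(x, t). u x t) (T (fst p), snd p) - (\<lambda>(x, t). u x t) p)"
    by (rule continuous_on_diff)
  then show ?thesis by (simp add: w_def case_prod_beta)
qed

lemma w_lateral:
  assumes "x \<in> frontier cap" "0 < t"
  shows "0 \<le> w x t" and "\<mu> < x \<bullet> \<omega> \<Longrightarrow> x \<in> frontier \<Omega>"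
proof -
  have x: "x \<in> closure cap" "x \<notin> cap"
    using assms(1) open_cap frontier_disjoint_eq frontier_def by blast+
  show lat: "x \<in> frontier \<Omega>" if "\<mu> < x \<bullet> \<omega>"
    using that x closure_cap closure_domain_cases mem_cap by blast
  show "0 \<le> w x t"
  proof (cases "x \<bullet> \<omega> = \<mu>")
    case True
    then show ?thesis by (simp add: w_def refl_hyp_fixed)
  next
    case False
    then have "u x t = 0" using lat closure_cap[OF x(1)] assms(2) solution_lateral by force
    then show ?thesis using solution_nonneg closure_cap(2)[OF x(1)] assms(2) by (simp add: w_def)
  qed
qed

lemma negligible_frontier_cap: "negligible (frontier cap)"
proof (rule negligible_subset)
  have "\<omega> \<noteq> 0" using unit by auto
  then have "negligible {x. \<omega> \<bullet> x = \<mu>}" by (intro negligible_hyperplane) simp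
  then show "negligible (frontier \<Omega> \<union> {x. \<omega> \<bullet> x = \<mu>})"
    using negligible_frontier_lipschitz_boundary[OF open_domain lipschitz] negligible_Un by blast
  show "frontier cap \<subseteq> frontier \<Omega> \<union> {x. \<omega> \<bullet> x = \<mu>}"
  proof
    fix x assume x: "x \<in> frontier cap"
    then have "\<mu> \<le> x \<bullet> \<omega>" using closure_cap(3) by (simp add: frontier_def)
    then show "x \<in> frontier \<Omega> \<union> {x. \<omega> \<bullet> x = \<mu>}"
      using w_lateral(2)[OF x zero_less_one] by (auto simp: inner_commute)
  qed
qed

lemma w_nonneg:
  assumes "x \<in> closure cap" "0 < t"
  shows "0 \<le> w x t"
proof (cases "x \<in> cap")
  case True
  obtain M where M: "\<And>x t. x \<in> \<Omega> \<Longrightarrow> 0 < t \<Longrightarrow> \<bar>u x t\<bar> \<le> M" by (rule solution_bound) blast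
  show ?thesis
  proof (rule minimum_principle_off_corner[OF open_cap _ negligible_frontier_cap w_continuous
        _ _ w_lateral(1) w_defect True assms(2)])
    show "bounded cap"
      using domain by (auto simp: bounded_domain_def cap_def intro: bounded_Int)
    show "- (2 * M) \<le> w y s" if "y \<in> cap" "0 < s" for y s
      using M[of y s] M[of "T y" s] that reflection_in_domain[of y] mem_cap[of y]
      by (auto simp: w_def)
    show "0 \<le> w y 0" if "y \<in> cap" for y
      using that reflection_in_domain[of y] mem_cap[of y] solution_initial by (simp add: w_def)
  qed
next
  case False
  then show ?thesis using assms closure_Un_frontier w_lateral(1) by blast
qed

lemma w_expanding_ball:
  assumes "0 < \<rho>" "\<rho> \<le> R" "0 < t1" "t1 < t2" and ball: "ball y R \<subseteq> cap"
    and pos: "\<And>x. x \<in> cball y \<rho> \<Longrightarrow> 0 < w x t1"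
  obtains c where "c > 0" "\<And>x. x \<in> cball y R \<Longrightarrow> c * (R\<^sup>2 - (norm (x - y))\<^sup>2) \<le> w x t2"
proof (rule expanding_ball_lower_bound[of \<rho> R t1 t2 y w])
  have cball: "cball y R \<subseteq> closure cap"
    using closure_mono[OF ball] closure_ball[of R y] assms(1,2) by simp
  then have "cball y R \<times> {t1..t2} \<subseteq> closure cap \<times> {0..} - frontier cap \<times> {0}"
    using \<open>0 < t1\<close> by auto
  then show "continuous_on (cball y R \<times> {t1..t2}) (\<lambda>(x, t). w x t)"
    using w_continuous continuous_on_subset by blast
  show "0 \<le> w x t" if "x \<in> cball y R" "t1 \<le> t" for x t
    using that cball \<open>0 < t1\<close> by (intro w_nonneg) auto
  show "has_heat_defect w x t 0" if "x \<in> ball y R" "t1 < t" for x t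
    using that ball \<open>0 < t1\<close> by (intro w_defect) auto
qed (use assms that in auto)

lemma w_spreads_in_ball:
  assumes "0 < t1" "t1 < t2" "ball y R \<subseteq> cap" "0 < w y t1" "x \<in> ball y R"
  shows "0 < w x t2"
proof -
  have "0 < R" using assms(5) by (smt (verit) mem_ball zero_le_dist)
  then have "y \<in> cap" using assms(3) by auto
  then have "y \<in> closure cap" using closure_subset by blast
  have "continuous_on cap (\<lambda>x. (\<lambda>(x, t). w x t) (x, t1))"
    using \<open>0 < t1\<close> closure_subset[of cap]
    by (intro continuous_on_compose2[OF w_continuous] continuous_intros) auto
  then have "isCont (\<lambda>x. w x t1) y"
    using \<open>y \<in> cap\<close> open_cap by (simp add: continuous_on_eq_continuous_at)
  then have "\<forall>\<^sub>F x in nhds y. 0 < w x t1"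
    using assms(4) by (simp add: isCont_def tendsto_nhds_iff order_tendstoD)
  then obtain e where "e > 0" and e: "\<And>x. dist x y < e \<Longrightarrow> 0 < w x t1"
    unfolding eventually_nhds_metric by blast
  define \<rho> where "\<rho> = min (e / 2) R"
  have "0 < \<rho>" "\<rho> \<le> R" using \<open>e > 0\<close> \<open>0 < R\<close> by (auto simp: \<rho>_def)
  moreover have "0 < w z t1" if "z \<in> cball y \<rho>" for z
    using that \<open>e > 0\<close> by (intro e) (auto simp: \<rho>_def dist_commute)
  ultimately obtain c where c: "c > 0"
      "\<And>x. x \<in> cball y R \<Longrightarrow> c * (R\<^sup>2 - (norm (x - y))\<^sup>2) \<le> w x t2"
    using w_expanding_ball[of \<rho> R t1 t2 y] assms by blast
  have "(norm (x - y))\<^sup>2 < R\<^sup>2"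
    using assms(5) by (intro power_strict_mono) (auto simp: dist_norm norm_minus_commute)
  then have "0 < c * (R\<^sup>2 - (norm (x - y))\<^sup>2)" using c(1) by simp
  also have "\<dots> \<le> w x t2" using c(2) assms(5) by auto
  finally show ?thesis .
qed

text \<open>
Positivity passes from a point to nearby points at any strictly later time. Asking for positivity at all
times after \<open>t1\<close> absorbs the small delay of each step, so the property is locally constant on \<open>C\<close>.
\<close>

lemma w_spreads:
  assumes C: "C \<subseteq> cap" "open C" "connected C" and "0 < t1"
    and a: "a \<in> C" "0 < w a t1" and "b \<in> C" "t1 < t"
  shows "0 < w b t"
proof -
  have "\<forall>t>t1. 0 < w b t"
  proof (rule connected_induction_simple[OF C(3) a(1) \<open>b \<in> C\<close>])
    obtain R where "R > 0" "ball a R \<subseteq> C" using C(2) a(1) open_contains_ball by blast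
    then show "\<forall>t>t1. 0 < w a t"
      using w_spreads_in_ball[of t1 _ a R a] C(1) a(2) \<open>0 < t1\<close> by auto
    fix x assume "x \<in> C"
    then obtain R where R: "R > 0" "ball x R \<subseteq> C" using C(2) open_contains_ball by blast
    have step: "\<forall>t>t1. 0 < w z' t"
      if z: "z \<in> ball x (R / 3)" "z' \<in> ball x (R / 3)" and pos: "\<forall>t>t1. 0 < w z t" for z z'
    proof (intro allI impI)
      fix t assume "t1 < t"
      \<comment> \<open>Half of the available delay is left for the step from \<open>z\<close> to \<open>z'\<close>.\<close>
      define s where "s = (t1 + t) / 2"
      have s: "t1 < s" "s < t" using \<open>t1 < t\<close> by (auto simp: s_def)
      have "ball z (2 * R / 3) \<subseteq> ball x R"
      proof
        fix v assume "v \<in> ball z (2 * R / 3)"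
        then show "v \<in> ball x R" using z(1) dist_triangle[of x v z] by simp
      qed
      then have "ball z (2 * R / 3) \<subseteq> cap" using R(2) C(1) by blast
      moreover have "z' \<in> ball z (2 * R / 3)"
        using z dist_triangle[of z z' x] by (simp add: dist_commute)
      ultimately show "0 < w z' t"
        using w_spreads_in_ball[of s t z] s pos \<open>0 < t1\<close> by simp
    qed
    have "openin (top_of_set C) (ball x (R / 3))"
      using R subset_ball[of "R / 3" R x] by (simp add: openin_open_eq[OF C(2)])
    moreover have "x \<in> ball x (R / 3)" using R(1) by simp
    moreover have "\<forall>z\<in>ball x (R / 3). \<forall>z'\<in>ball x (R / 3).
        (\<forall>t>t1. 0 < w z t) \<longrightarrow> (\<forall>t>t1. 0 < w z' t)"
      by (intro ballI impI) (rule step)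
    ultimately show "\<exists>V. openin (top_of_set C) V \<and> x \<in> V \<and>
        (\<forall>z\<in>V. \<forall>z'\<in>V. (\<forall>t>t1. 0 < w z t) \<longrightarrow> (\<forall>t>t1. 0 < w z' t))"
      by (intro exI[of _ "ball x (R / 3)"] conjI)
  qed
  then show ?thesis using \<open>t1 < t\<close> by blast
qed

text \<open>
The Hopf estimate at a point where the ball touches the hyperplane: the expanding-ball bound makes \<open>w\<close>
grow at least linearly along the normal at \<open>x0\<close>, whereas a vanishing gradient of \<open>u\<close> makes its normal
derivative 0.
\<close>

lemma not_critical_of_positive:
  assumes x0: "x0 \<bullet> \<omega> = \<mu>" and "0 < R" and ball: "ball (x0 + R *\<^sub>R \<omega>) R \<subseteq> cap"
    and "0 < t1" "t1 < t0"
    and pos: "\<And>x. x \<in> cball (x0 + R *\<^sub>R \<omega>) (R / 2) \<Longrightarrow> 0 < w x t1"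
  shows "\<not> spatial_critical_point u t0 x0"
proof
  assume crit: "spatial_critical_point u t0 x0"
  let ?y = "x0 + R *\<^sub>R \<omega>"
  obtain c where "c > 0"
      and c: "\<And>x. x \<in> cball ?y R \<Longrightarrow> c * (R\<^sup>2 - (norm (x - ?y))\<^sup>2) \<le> w x t0"
    using w_expanding_ball[of "R / 2" R t1 t0 ?y] assms by auto
  have lower: "c * R * s \<le> w (x0 + s *\<^sub>R \<omega>) t0" if s: "0 < s" "s < R" for s
  proof -
    have "x0 + s *\<^sub>R \<omega> - ?y = (s - R) *\<^sub>R \<omega>" by (simp add: algebra_simps)
    then have n: "norm (x0 + s *\<^sub>R \<omega> - ?y) = R - s" using s unit by simp
    then have "x0 + s *\<^sub>R \<omega> \<in> cball ?y R" using s by (simp add: dist_norm norm_minus_commute)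
    from c[OF this] have "c * (R\<^sup>2 - (R - s)\<^sup>2) \<le> w (x0 + s *\<^sub>R \<omega>) t0" unfolding n .
    moreover have "R\<^sup>2 - (R - s)\<^sup>2 = R * s + s * (R - s)"
      by (simp add: power2_eq_square algebra_simps)
    moreover have "c * (R * s) \<le> c * (R * s + s * (R - s))" using s \<open>c > 0\<close> by simp
    ultimately show ?thesis by (simp add: mult.assoc)
  qed
  have T_line: "T (x0 + s *\<^sub>R \<omega>) = x0 + s *\<^sub>R (- \<omega>)" for s
    using unit x0 by (simp add: refl_hyp_def inner_add_left norm_eq_1 vec_eq_iff algebra_simps)
  have "((\<lambda>y. u y t0) has_derivative (\<lambda>h. 0)) (at x0)"
    using crit by (simp add: spatial_critical_point_def gderiv_def)
  then have line: "((\<lambda>s. u (x0 + s *\<^sub>R h) t0) has_real_derivative 0) (at 0)" for h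
    using has_derivative_along_line[of "\<lambda>y. u y t0" "\<lambda>h. 0" x0 0 h] by simp
  define k where "k s = w (x0 + s *\<^sub>R \<omega>) t0 - c * R * s" for s
  have "(k has_real_derivative 0 - 0 - c * R * 1) (at 0)"
    unfolding k_def w_def T_line
    by (intro DERIV_diff line DERIV_cmult DERIV_ident)
  then have "(k has_real_derivative - (c * R)) (at 0)" by simp
  moreover have "- (c * R) < 0" using \<open>c > 0\<close> \<open>0 < R\<close> by simp
  ultimately obtain d where d: "d > 0" "\<And>h. 0 < h \<Longrightarrow> h < d \<Longrightarrow> k h < k 0"
    using DERIV_neg_dec_right[of k "- (c * R)" 0] by auto
  define h where "h = min d R / 2"
  have "0 < h" "h < d" "h < R" using d \<open>0 < R\<close> by (auto simp: h_def)
  then have "k h < k 0" "0 \<le> k h" using d(2) lower by (auto simp: k_def)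
  moreover have "k 0 = 0" using x0 by (simp add: k_def w_def refl_hyp_fixed)
  ultimately show False by simp
qed

text \<open>
The mirror-symmetric set generated by \<open>C\<close>, including the points of the hyperplane that \<open>C\<close> touches.
\<close>

definition reflected_union :: "(real ^ 'n) set \<Rightarrow> (real ^ 'n) set" where
  "reflected_union C = C \<union> T ` C \<union> {x \<in> closure C. x \<bullet> \<omega> = \<mu>}"

text \<open>
It is shown that \<open>\<Omega>\<close> lies in \<open>reflected_union C\<close>, by connectedness of \<open>\<Omega>\<close>: membership is locally
constant. Above the hyperplane this is because \<open>C\<close> is a component of the cap, on it because small
half-balls are connected. Below it the only danger is a point of \<open>\<Omega>\<close> whose mirror image is a boundary
point of \<open>\<Omega>\<close> in the closure of \<open>C\<close>; there \<open>w\<close> would equal \<open>u > 0\<close> although it vanishes on \<open>C\<close>.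
\<close>

lemma symmetric_of_vanishing:
  assumes C: "C \<in> components cap" and "0 < t" and zero: "\<And>x. x \<in> C \<Longrightarrow> w x t = 0"
  shows "symmetric_wrt \<Omega> \<mu> \<omega>"
proof -
  note invol = refl_hyp_involution[OF unit] and inner = refl_hyp_inner[OF unit]
  have C_cap: "C \<subseteq> cap" using C in_components_subset by blast
  have "open C" using C open_cap open_components by blast
  have C_ne: "C \<noteq> {}" using C in_components_nonempty by blast
  have absorb: "A \<subseteq> C" if "connected A" "A \<subseteq> cap" "x \<in> A" "x \<in> C" for A x
    using components_maximal[OF C that(1,2)] that(3,4) by blast
  have mem: "x \<in> reflected_union C \<longleftrightarrow> x \<in> C \<or> T x \<in> C \<or> x \<in> closure C \<and> x \<bullet> \<omega> = \<mu>" for x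
    unfolding reflected_union_def using invol by (metis (mono_tags, lifting) Un_iff imageE imageI mem_Collect_eq)
  have above: "x \<in> reflected_union C \<longleftrightarrow> x \<in> C" if "\<mu> < x \<bullet> \<omega>" for x
    using that C_cap mem_cap[of "T x"] inner[of \<mu> x] by (auto simp: mem)
  have below: "x \<in> reflected_union C \<longleftrightarrow> T x \<in> C" if "x \<bullet> \<omega> < \<mu>" for x
    using that C_cap mem_cap[of x] by (auto simp: mem)
  \<comment> \<open>By continuity \<open>w\<close> vanishes at \<open>b\<close>, but its value there is \<open>u (T b) t\<close>, which is positive.\<close>
  have no_frontier: "b \<notin> closure C" if b: "b \<in> frontier \<Omega>" "T b \<in> \<Omega>" for b
  proof
    assume bC: "b \<in> closure C"
    have "continuous_on (closure C) (\<lambda>x. (\<lambda>(x, t). w x t) (x, t))"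
      using closure_mono[OF C_cap] \<open>0 < t\<close>
      by (intro continuous_on_compose2[OF w_continuous] continuous_intros) auto
    then have "w b t = 0"
      using continuous_constant_on_closure[of C "\<lambda>x. w x t" 0 b] zero bC by auto
    then show False using solution_pos[OF b(2) \<open>0 < t\<close>] solution_lateral[OF b(1) \<open>0 < t\<close>]
      by (simp add: w_def)
  qed
  have in_cap_nbhd: "\<exists>e>0. ball b e \<subseteq> cap \<and> (ball b e \<subseteq> C \<or> ball b e \<inter> C = {})" if b: "b \<in> cap" for b
  proof -
    obtain e where "e > 0" "ball b e \<subseteq> cap" using b open_cap open_contains_ball by blast
    then show ?thesis using absorb[OF connected_ball] by blast
  qed
  have nbhd: "\<exists>V. open V \<and> a \<in> V \<and> V \<subseteq> \<Omega> \<and> (\<forall>x\<in>V. \<forall>y\<in>V. x \<in> reflected_union C \<longrightarrow> y \<in> reflected_union C)"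
    if a: "a \<in> \<Omega>" for a
  proof -
    consider "\<mu> < a \<bullet> \<omega>" | "a \<bullet> \<omega> < \<mu>" | "a \<bullet> \<omega> = \<mu>" by linarith
    then show ?thesis
    proof cases
      case 1
      then have "a \<in> cap" using a mem_cap by blast
      then obtain e where e: "e > 0" "ball a e \<subseteq> cap" "ball a e \<subseteq> C \<or> ball a e \<inter> C = {}"
        using in_cap_nbhd by blast
      then have "x \<in> reflected_union C \<longleftrightarrow> x \<in> C" if "x \<in> ball a e" for x
        using above mem_cap that by blast
      then show ?thesis using e mem_cap by (intro exI[of _ "ball a e"]) auto
    next
      case 2
      obtain e where e: "e > 0" "ball (T a) e \<subseteq> C \<or> ball (T a) e \<inter> C = {}"
      proof (cases "T a \<in> cap")
        case True
        then show thesis using in_cap_nbhd that by blast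
      next
        case False
        then have "T a \<notin> \<Omega>" using 2 inner[of \<mu> a] mem_cap[of "T a"] by simp
        then have "T a \<notin> closure C"
          using no_frontier[of "T a"] closure_cap(1) closure_mono[OF C_cap] closure_domain_cases a invol
          by (metis subsetD)
        then obtain e where "e > 0" "ball (T a) e \<subseteq> - closure C"
          using open_contains_ball[of "- closure C"] by auto
        then show thesis using that closure_subset by blast
      qed
      define V where "V = ball a e \<inter> \<Omega> \<inter> {x. x \<bullet> \<omega> < \<mu>}"
      have "open V"
        unfolding V_def using open_domain
        by (intro open_Int open_ball open_Collect_less continuous_intros)
      moreover have "\<forall>x\<in>V. \<forall>y\<in>V. x \<in> reflected_union C \<longrightarrow> y \<in> reflected_union C"
      proof -
        have "x \<in> reflected_union C \<longleftrightarrow> T x \<in> C" "T x \<in> ball (T a) e" if "x \<in> V" for x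
          using that below refl_hyp_ball[OF unit] by (auto simp: V_def simp del: mem_ball)
        then show ?thesis using e(2) by blast
      qed
      moreover have "a \<in> V" "V \<subseteq> \<Omega>" using e(1) a 2 by (auto simp: V_def)
      ultimately show ?thesis by blast
    next
      case 3
      then have Ta: "T a = a" by (rule refl_hyp_fixed)
      obtain e where e: "e > 0" "ball a e \<subseteq> \<Omega>" using a open_domain open_contains_ball by blast
      define H where "H = ball a e \<inter> {x. \<mu> < x \<bullet> \<omega>}"
      have "convex {x. \<mu> < x \<bullet> \<omega>}" using convex_halfspace_gt[of \<mu> \<omega>] by (simp add: inner_commute)
      then have "connected H" unfolding H_def by (intro convex_connected convex_Int convex_ball)
      have H_cap: "H \<subseteq> cap" using e by (auto simp: H_def mem_cap)
      have T_ball: "T x \<in> ball a e \<longleftrightarrow> x \<in> ball a e" for x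
        using refl_hyp_ball[OF unit, of \<mu> x a e] Ta by simp
      have preserved: "y \<in> reflected_union C"
        if x: "x \<in> ball a e" "x \<in> reflected_union C" and y: "y \<in> ball a e" for x y
      proof -
        have "\<exists>z\<in>H. z \<in> C"
        proof -
          consider "x \<in> C" | "T x \<in> C" | "x \<in> closure C" using x(2) mem by blast
          then show ?thesis
          proof cases
            case 1
            then show ?thesis using x(1) C_cap mem_cap unfolding H_def by blast
          next
            case 2
            then show ?thesis using x(1) T_ball C_cap mem_cap unfolding H_def by blast
          next
            case 3
            then obtain z where "z \<in> C" "z \<in> ball a e"
              using closure_disjoint_from_open[OF open_ball x(1), of C] by blast
            then show ?thesis using C_cap mem_cap unfolding H_def by blast
          qed
        qed
        then have HC: "H \<subseteq> C" using absorb[OF \<open>connected H\<close> H_cap] by blast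
        consider "\<mu> < y \<bullet> \<omega>" | "y \<bullet> \<omega> < \<mu>" | "y \<bullet> \<omega> = \<mu>" by linarith
        then show ?thesis
        proof cases
          case 1
          then have "y \<in> H" using y by (simp add: H_def)
          then show ?thesis using HC mem by blast
        next
          case 2
          then have "T y \<in> H" using y T_ball inner[of \<mu> y] by (simp add: H_def del: mem_ball)
          then show ?thesis using HC mem by blast
        next
          case 3
          have "y \<in> closure H"
            unfolding closure_approachable
          proof (intro allI impI)
            fix \<delta> :: real assume "\<delta> > 0"
            define s where "s = min \<delta> (e - dist a y) / 2"
            have s: "0 < s" "s < \<delta>" "s < e - dist a y" using \<open>\<delta> > 0\<close> y by (auto simp: s_def)
            have "dist (y + s *\<^sub>R \<omega>) y = s" using unit s by (simp add: dist_norm)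
            moreover from this have "y + s *\<^sub>R \<omega> \<in> ball a e"
              using dist_triangle[of a "y + s *\<^sub>R \<omega>" y] s by (simp add: dist_commute)
            moreover have "\<mu> < (y + s *\<^sub>R \<omega>) \<bullet> \<omega>"
              using 3 s unit by (simp add: inner_add_left norm_eq_1)
            ultimately show "\<exists>z\<in>H. dist z y < \<delta>"
              using s by (intro bexI[of _ "y + s *\<^sub>R \<omega>"]) (auto simp: H_def)
          qed
          then show ?thesis using 3 closure_mono[OF HC] mem by blast
        qed
      qed
      have "a \<in> ball a e" using e(1) by simp
      then show ?thesis using open_ball e(2) preserved by (intro exI[of _ "ball a e"]) blast
    qed
  qed
  obtain c where c: "c \<in> C" using C_ne by blast
  have all: "x \<in> reflected_union C" if x: "x \<in> \<Omega>" for x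
  proof (rule connected_induction_simple[of \<Omega> c x])
    show "connected \<Omega>" using domain by (simp add: bounded_domain_def)
    show "c \<in> \<Omega>" "x \<in> \<Omega>" using c C_cap mem_cap x by blast+
    show "c \<in> reflected_union C" using c mem by blast
    fix a assume "a \<in> \<Omega>"
    obtain V where V: "open V \<and> a \<in> V \<and> V \<subseteq> \<Omega> \<and>
        (\<forall>x\<in>V. \<forall>y\<in>V. x \<in> reflected_union C \<longrightarrow> y \<in> reflected_union C)"
      using nbhd[OF \<open>a \<in> \<Omega>\<close>] ..
    then have "openin (top_of_set \<Omega>) V" by (simp add: openin_open_eq[OF open_domain])
    then show "\<exists>V. openin (top_of_set \<Omega>) V \<and> a \<in> V \<and>
        (\<forall>x\<in>V. \<forall>y\<in>V. x \<in> reflected_union C \<longrightarrow> y \<in> reflected_union C)"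
      using V by (intro exI[of _ V]) simp
  qed
  have stable: "T x \<in> \<Omega>" if x: "x \<in> \<Omega>" for x
  proof -
    consider "x \<in> C" | "T x \<in> C" | "x \<bullet> \<omega> = \<mu>" using all[OF x] mem by blast
    then show ?thesis
    proof cases
      case 1
      then show ?thesis using C_cap reflection_in_domain by blast
    next
      case 2
      then show ?thesis using C_cap mem_cap by blast
    next
      case 3
      then show ?thesis using refl_hyp_fixed[of x \<omega> \<mu>] x by simp
    qed
  qed
  have "T ` \<Omega> \<subseteq> \<Omega>" by (rule image_subsetI) (rule stable)
  moreover have "\<Omega> \<subseteq> T ` \<Omega>"
  proof
    fix x assume "x \<in> \<Omega>"
    from imageI[OF stable[OF this], of T] show "x \<in> T ` \<Omega>" by (simp only: invol)
  qed
  ultimately show ?thesis unfolding symmetric_wrt_def by (rule equalityI)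
qed

text \<open>
The vanishing alternative is excluded at time \<open>t0 / 3\<close>; the positivity found there has spread over \<open>C\<close> at
time \<open>t0 / 2\<close>, which leaves time for the Hopf estimate at \<open>t0\<close>.
\<close>

lemma no_critical_point:
  assumes x0: "x0 \<in> \<Omega>" "x0 \<bullet> \<omega> = \<mu>" and "0 < t0" and asym: "\<not> symmetric_wrt \<Omega> \<mu> \<omega>"
  shows "\<not> spatial_critical_point u t0 x0"
proof -
  obtain e where e: "e > 0" "ball x0 e \<subseteq> \<Omega>" using x0 open_domain open_contains_ball by blast
  define R where "R = e / 2"
  define y where "y = x0 + R *\<^sub>R \<omega>"
  have "R > 0" using e by (simp add: R_def)
  have ball_cap: "ball y R \<subseteq> cap"
  proof
    fix z assume z: "z \<in> ball y R"
    have "dist x0 y = R" using unit \<open>R > 0\<close> by (simp add: y_def dist_norm)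
    then have "z \<in> ball x0 e" using z dist_triangle[of x0 z y] by (simp add: R_def)
    moreover have "\<bar>(z - y) \<bullet> \<omega>\<bar> < R"
      using Cauchy_Schwarz_ineq2[of "z - y" \<omega>] z unit by (simp add: dist_norm norm_minus_commute)
    moreover have "y \<bullet> \<omega> = \<mu> + R" using x0 unit by (simp add: y_def inner_add_left norm_eq_1)
    ultimately show "z \<in> cap" using e by (auto simp: mem_cap inner_diff_left)
  qed
  define C where "C = connected_component_set cap y"
  have "y \<in> cap" using ball_cap \<open>R > 0\<close> by auto
  then have C: "C \<in> components cap" by (simp add: C_def componentsI)
  have ball_C: "ball y R \<subseteq> C"
    unfolding C_def using ball_cap \<open>R > 0\<close> by (intro connected_component_maximal) auto
  have "\<exists>x\<in>C. w x (t0 / 3) \<noteq> 0"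
    using symmetric_of_vanishing[OF C, of "t0 / 3"] \<open>0 < t0\<close> asym by auto
  then obtain a where a: "a \<in> C" "w a (t0 / 3) \<noteq> 0" by blast
  have C_cap: "C \<subseteq> cap" using C in_components_subset by blast
  have "a \<in> closure cap" using a(1) C_cap closure_subset by blast
  then have pos: "0 < w a (t0 / 3)" using a(2) w_nonneg[of a "t0 / 3"] \<open>0 < t0\<close> by simp
  have "0 < w x (t0 / 2)" if "x \<in> C" for x
    using w_spreads[OF C_cap _ _ _ a(1) pos that, of "t0 / 2"] C open_cap \<open>0 < t0\<close>
      open_components in_components_connected by auto
  then have "0 < w x (t0 / 2)" if "x \<in> cball y (R / 2)" for x
    using that ball_C \<open>R > 0\<close> by (simp add: subset_iff)
  then show ?thesis
    using not_critical_of_positive[of x0 R "t0 / 2" t0] x0 \<open>R > 0\<close> ball_cap \<open>0 < t0\<close>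
    by (simp add: y_def)
qed

end

theorem proposition3p1:
  fixes \<Omega> :: "(real ^ 'n) set" and \<omega> :: "real ^ 'n" and \<mu> :: real
    and u :: "real ^ 'n \<Rightarrow> real \<Rightarrow> real"
  assumes "CARD('n) \<ge> 2"
    and "bounded_domain \<Omega>"
    and "lipschitz_boundary \<Omega>"
    and "norm \<omega> = 1"
    and "hyperplane_at \<mu> \<omega> \<inter> \<Omega> \<noteq> {}"
    and "refl_hyp \<mu> \<omega> ` (\<Omega> \<inter> upper_halfspace \<mu> \<omega>) \<subseteq> \<Omega>"
    and "heat_solution \<Omega> u"
    and "\<not> symmetric_wrt \<Omega> \<mu> \<omega>"
  shows "\<not> (\<exists>x \<in> \<Omega> \<inter> hyperplane_at \<mu> \<omega>. \<exists>t > 0. spatial_critical_point u t x)"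
proof -
  have "reflected_heat_flow \<Omega> \<omega> \<mu> u"
    using assms(2,3,4,6,7) by (rule reflected_heat_flow.intro)
  note no_critical = reflected_heat_flow.no_critical_point[OF this _ _ _ assms(8)]
  show ?thesis
  proof (rule notI)
    assume "\<exists>x \<in> \<Omega> \<inter> hyperplane_at \<mu> \<omega>. \<exists>t > 0. spatial_critical_point u t x"
    then obtain x t where "x \<in> \<Omega>" "x \<bullet> \<omega> = \<mu>" "0 < t" "spatial_critical_point u t x"
      unfolding hyperplane_at_def by blast
    then show False using no_critical by blast
  qed
qed

end
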